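(* For every constant $k\ge 2$ there is a polynomial-time algorithm $A$ such that the following holds. Let $f\colon\{0,1\}^n\to\{0,1\}$ with $f\in Q_k$, and let $\pi$ be a $k$-party dag-like protocol with inputs from $f^{-1}(0)\times\dots\times f^{-1}(0)$ and outputs in $[n]$ which strongly computes the $Q_k$-communication game for $f$. Then, given the light form of $\pi$, $A$ outputs a circuit $C\le f$ consisting only of $\mathrm{THR}^{k+1}_2$ gates and variables, with $\mathrm{depth}(C)=O(\mathrm{depth}(\pi))$ and $\mathrm{size}(C)=O(\mathrm{size}(\pi)^{O(1)})$.
   Context: $Q_k$ is the set of $f\colon\{0,1\}^n\to\{0,1\}$ such that any $x^1,\dots,x^k\in f^{-1}(0)$ have a common coordinate $i$ with $x^1_i=\dots=x^k_i=0$. A $k$-party dag-like protocol with inputs from $\mathcal X_1\times\dots\times\mathcal X_k$ and outputs from $\mathcal Y$ is a tuple $\pi=\langle G,P_1,\dots,P_k,\phi_1,\dots,\phi_k,l\rangle$ where: $G$ is a finite directed acyclic multigraph with a starting node $s$ from which every node is reachable, in which every non-terminal node (node with outgoing edges) has exactly two outgoing edges, labeled $0$ and $1$; $P_1,\dots,P_k$ partition the non-terminal nodes; $\phi_i\colon P_i\times\mathcal X_i\to\{0,1\}$; and $l$ maps terminal nodes to $\mathcal Y$. $\mathrm{depth}(\pi)$ is the maximal length of a path from $s$; $\mathrm{size}(\pi)$ is the number of nodes of $G$. An $x\in\mathcal X_i$ is $i$-compatible with an edge $e$ from $v$ if $v\notin P_i$ or $e$ is labeled $\phi_i(v,x)$;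 with a path if it is $i$-compatible with all its edges; with a node $v$ if some path from $s$ to $v$ is $i$-compatible with $x$. The light form of $\pi$ is $\langle G,P_1,\dots,P_k,l\rangle$. Here $\mathcal X_i=f^{-1}(0)$, $\mathcal Y=[n]$, and $\pi$ strongly computes the $Q_k$-communication game for $f$ if for every terminal $t$, every $x\in f^{-1}(0)$ and every $i\in[k]$: if $x$ is $i$-compatible with $t$ then $x_{l(t)}=0$. A circuit consisting only of $\mathrm{THR}^{k+1}_2$ gates ($\mathrm{THR}^{k+1}_2$ outputs $1$ iff at least two of its $k+1$ inputs are $1$) and variables is a DAG with an output node, internal nodes $\mathrm{THR}^{k+1}_2$ gates with $k+1$ ordered inputs, input nodes labeled by variables $x_i$ (no constants, no negations); depth is the longest output-to-input path length, size the number of nodes. $C\le f$ means $C(x)=0$ for all $x\in f^{-1}(0)$. *)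

theory Defs
  imports "HOL-Library.Disjoint_Sets" "Graph_Theory.Arc_Walk"
begin

section \<open>Boolean functions and the class Q\<close>

text \<open>
  Points of the cube are the lists of length \<open>n\<close>, with coordinates \<open>{..<n}\<close> (counted from 0).
  A Boolean function is given by any HOL function that agrees with it on these lists;
  its values on lists of other lengths are never used.
\<close>

definition zeros :: "nat \<Rightarrow> (bool list \<Rightarrow> bool) \<Rightarrow> bool list set" where
  "zeros n f = {x. length x = n \<and> \<not> f x}"

definition Q :: "nat \<Rightarrow> nat \<Rightarrow> (bool list \<Rightarrow> bool) set" where
  "Q k n = {f. \<forall>x :: nat \<Rightarrow> bool list. (\<forall>j\<in>{1..k}. x j \<in> zeros n f) \<longrightarrow>
                 (\<exists>i<n. \<forall>j\<in>{1..k}. \<not> x j ! i)}"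

section \<open>Dag-like protocols\<close>

record light_form =
  dag :: "(nat, nat) pre_digraph"
  start :: nat
  arc_label :: "nat \<Rightarrow> bool"
  part :: "nat \<Rightarrow> nat set"
  out_label :: "nat \<Rightarrow> nat"

text \<open>
  \<open>arc_label e\<close> is the label of the arc \<open>e\<close>, \<open>part i\<close> is the set of nodes of party \<open>i \<in> {1..k}\<close>.
  Only the values of \<open>msg i\<close> (the function of party \<open>i\<close>) on \<open>part i\<close> and on the inputs
  of that party are relevant.
\<close>

record 'x protocol = light_form +
  msg :: "nat \<Rightarrow> nat \<Rightarrow> 'x \<Rightarrow> bool"

definition light_form_of :: "'x protocol \<Rightarrow> light_form" where
  "light_form_of \<pi> = light_form.truncate \<pi>"

definition terminals :: "'z light_form_scheme \<Rightarrow> nat set" where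
  "terminals L = {v \<in> verts (dag L). out_arcs (dag L) v = {}}"

definition is_protocol :: "nat \<Rightarrow> nat set \<Rightarrow> 'x protocol \<Rightarrow> bool" where
  "is_protocol k Y \<pi> \<longleftrightarrow>
     fin_digraph (dag \<pi>) \<and> acyclic (arcs_ends (dag \<pi>)) \<and>
     start \<pi> \<in> verts (dag \<pi>) \<and>
     (\<forall>v\<in>verts (dag \<pi>). reachable (dag \<pi>) (start \<pi>) v) \<and>
     (\<forall>v\<in>verts (dag \<pi>) - terminals \<pi>. bij_betw (arc_label \<pi>) (out_arcs (dag \<pi>) v) UNIV) \<and>
     (\<Union>i\<in>{1..k}. part \<pi> i) = verts (dag \<pi>) - terminals \<pi> \<and>
     disjoint_family_on (part \<pi>) {1..k} \<and>
     out_label \<pi> ` terminals \<pi> \<subseteq> Y"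

definition protocol_depth :: "'x protocol \<Rightarrow> nat" where
  "protocol_depth \<pi> = Max {length p | p v. pre_digraph.awalk (dag \<pi>) (start \<pi>) p v}"

definition protocol_size :: "'x protocol \<Rightarrow> nat" where
  "protocol_size \<pi> = card (verts (dag \<pi>))"

definition compatible_arc :: "'x protocol \<Rightarrow> nat \<Rightarrow> 'x \<Rightarrow> nat \<Rightarrow> bool" where
  "compatible_arc \<pi> i x e \<longleftrightarrow>
     tail (dag \<pi>) e \<notin> part \<pi> i \<or> arc_label \<pi> e = msg \<pi> i (tail (dag \<pi>) e) x"

definition compatible :: "'x protocol \<Rightarrow> nat \<Rightarrow> 'x \<Rightarrow> nat \<Rightarrow> bool" where
  "compatible \<pi> i x v \<longleftrightarrow>
     (\<exists>p. pre_digraph.awalk (dag \<pi>) (start \<pi>) p v \<and> (\<forall>e\<in>set p. compatible_arc \<pi> i x e))"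

definition strongly_computes ::
    "nat \<Rightarrow> nat \<Rightarrow> (bool list \<Rightarrow> bool) \<Rightarrow> bool list protocol \<Rightarrow> bool" where
  "strongly_computes k n f \<pi> \<longleftrightarrow>
     (\<forall>t\<in>terminals \<pi>. \<forall>x\<in>zeros n f. \<forall>i\<in>{1..k}.
        compatible \<pi> i x t \<longrightarrow> \<not> x ! out_label \<pi> t)"

section \<open>Threshold circuits\<close>

datatype gate = Input nat | Thr "nat list"

record circuit =
  nodes :: "nat set"
  out :: nat
  gate :: "nat \<Rightarrow> gate"

definition wires :: "circuit \<Rightarrow> (nat \<times> nat) set" where
  "wires C = {(u, v). u \<in> nodes C \<and> (\<exists>vs. gate C u = Thr vs \<and> v \<in> set vs)}"

definition thr_circuit :: "nat \<Rightarrow> nat \<Rightarrow> circuit \<Rightarrow> bool" where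
  "thr_circuit m n C \<longleftrightarrow>
     finite (nodes C) \<and> out C \<in> nodes C \<and> acyclic (wires C) \<and>
     (\<forall>v\<in>nodes C. case gate C v of
        Input i \<Rightarrow> i < n
      | Thr vs \<Rightarrow> length vs = m \<and> set vs \<subseteq> nodes C)"

definition thr2 :: "bool list \<Rightarrow> bool" where
  "thr2 bs \<longleftrightarrow> 2 \<le> length (filter id bs)"

inductive node_value :: "circuit \<Rightarrow> bool list \<Rightarrow> nat \<Rightarrow> bool \<Rightarrow> bool" for C x where
  "gate C v = Input i \<Longrightarrow> node_value C x v (x ! i)"
| "gate C v = Thr vs \<Longrightarrow> list_all2 (node_value C x) vs bs \<Longrightarrow> node_value C x v (thr2 bs)"

text \<open>The value at a node is unique, and it exists in a well-formed circuit.\<close>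

lemma node_value_unique:
  assumes "node_value C x v a" "node_value C x v b"
  shows "a = b"
  using assms
proof (induction arbitrary: b rule: node_value.induct)
  case (1 v i)
  from 1(2) show ?case by cases (use 1(1) in auto)
next
  case (2 v vs bs)
  from 2(3) obtain cs where cs: "list_all2 (node_value C x) vs cs" "b = thr2 cs"
    by cases (use 2(1) in auto)
  have "list_all2 (\<lambda>v a. \<forall>b. node_value C x v b \<longrightarrow> a = b) vs bs"
    using 2(2) by (rule list_all2_mono) auto
  then have "bs = cs"
    using cs(1) by (simp add: list_eq_iff_nth_eq list_all2_conv_all_nth)
  with cs(2) show ?case by simp
qed

lemma node_value_exists:
  assumes C: "thr_circuit m n C" and "v \<in> nodes C"
  shows "\<exists>b. node_value C x v b"
proof -
  have "wires C \<subseteq> nodes C \<times> nodes C"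
    using C by (fastforce simp: wires_def thr_circuit_def split: gate.splits)
  then have "finite (wires C)"
    using C by (meson finite_SigmaI finite_subset thr_circuit_def)
  then have "wf ((wires C)\<inverse>)"
    using C by (intro finite_acyclic_wf_converse) (auto simp: thr_circuit_def)
  then show ?thesis
    using \<open>v \<in> nodes C\<close>
  proof (induction v rule: wf_induct_rule)
    case (less v)
    show ?case
    proof (cases "gate C v")
      case (Input i)
      then show ?thesis using node_value.intros(1) by blast
    next
      case (Thr vs)
      then have "\<forall>u\<in>set vs. \<exists>b. node_value C x u b"
        using less C by (fastforce simp: wires_def thr_circuit_def split: gate.splits)
      then obtain g where "\<forall>u\<in>set vs. node_value C x u (g u)"
        by metis
      then have "list_all2 (node_value C x) vs (map g vs)"
        by (auto simp: list_all2_conv_all_nth)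
      then show ?thesis using Thr node_value.intros(2) by blast
    qed
  qed
qed

definition circuit_value :: "circuit \<Rightarrow> bool list \<Rightarrow> bool" where
  "circuit_value C x = (THE b. node_value C x (out C) b)"

definition circuit_le :: "nat \<Rightarrow> circuit \<Rightarrow> (bool list \<Rightarrow> bool) \<Rightarrow> bool" where
  "circuit_le n C f \<longleftrightarrow> (\<forall>x\<in>zeros n f. \<not> circuit_value C x)"

definition circuit_depth :: "circuit \<Rightarrow> nat" where
  "circuit_depth C = Max {m. \<exists>v i. (out C, v) \<in> wires C ^^ m \<and> gate C v = Input i}"

definition circuit_size :: "circuit \<Rightarrow> nat" where
  "circuit_size C = card (nodes C)"

section \<open>Polynomial-time algorithms\<close>

text \<open>
  The machine model is the WHILE language over binary trees of Jones (Computability and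
  Complexity from a Programming Perspective). In contrast to unit-cost accounting, the
  evaluation of an expression is charged for the full size of all trees which it reads.
  Hence an assignment costs at least the size of the assigned tree (see \<open>dsize_eval_le\<close>), the
  total size of the store is at most the initial size plus the running time up to a constant
  depending on the program, and time in this model and time on a multitape Turing machine are
  related by polynomials in both directions.
\<close>

datatype data = DNil | DCons data data

fun dsize :: "data \<Rightarrow> nat" where
  "dsize DNil = 1"
| "dsize (DCons a b) = Suc (dsize a + dsize b)"

fun dhd :: "data \<Rightarrow> data" where
  "dhd DNil = DNil"
| "dhd (DCons a b) = a"

fun dtl :: "data \<Rightarrow> data" where
  "dtl DNil = DNil"
| "dtl (DCons a b) = b"

datatype expr = Var nat | Nil_E | Cons_E expr expr | Hd_E expr | Tl_E expr | Eq_E expr expr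

type_synonym store = "nat \<Rightarrow> data"

fun of_bool_data :: "bool \<Rightarrow> data" where
  "of_bool_data False = DNil"
| "of_bool_data True = DCons DNil DNil"

fun eval_expr :: "expr \<Rightarrow> store \<Rightarrow> data" where
  "eval_expr (Var x) s = s x"
| "eval_expr Nil_E s = DNil"
| "eval_expr (Cons_E a b) s = DCons (eval_expr a s) (eval_expr b s)"
| "eval_expr (Hd_E a) s = dhd (eval_expr a s)"
| "eval_expr (Tl_E a) s = dtl (eval_expr a s)"
| "eval_expr (Eq_E a b) s = of_bool_data (eval_expr a s = eval_expr b s)"

fun cost :: "expr \<Rightarrow> store \<Rightarrow> nat" where
  "cost (Var x) s = dsize (s x)"
| "cost Nil_E s = 1"
| "cost (Cons_E a b) s = Suc (cost a s + cost b s)"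
| "cost (Hd_E a) s = Suc (cost a s)"
| "cost (Tl_E a) s = Suc (cost a s)"
| "cost (Eq_E a b) s = Suc (cost a s + cost b s)"

lemma dsize_pos: "0 < dsize d"
  by (cases d) auto

lemma dsize_eval_le: "dsize (eval_expr e s) \<le> cost e s"
proof (induction e)
  case (Hd_E e)
  then show ?case by (cases "eval_expr e s") auto
next
  case (Tl_E e)
  then show ?case by (cases "eval_expr e s") auto
next
  case (Eq_E a b)
  then show ?case
    using dsize_pos[of "eval_expr a s"] dsize_pos[of "eval_expr b s"]
    by (cases "eval_expr a s = eval_expr b s") auto
qed auto

datatype com =
    Assign nat expr
  | Seq com com
  | Cond expr com com
  | While expr com

text \<open>\<open>exec c s t s'\<close>: started in \<open>s\<close>, the program \<open>c\<close> halts in \<open>s'\<close> after time \<open>t\<close>.\<close>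

inductive exec :: "com \<Rightarrow> store \<Rightarrow> nat \<Rightarrow> store \<Rightarrow> bool" where
  Assign: "exec (Assign x e) s (Suc (cost e s)) (s(x := eval_expr e s))"
| Seq: "exec c1 s t1 s1 \<Longrightarrow> exec c2 s1 t2 s2 \<Longrightarrow> exec (Seq c1 c2) s (t1 + t2) s2"
| CondTrue: "eval_expr e s \<noteq> DNil \<Longrightarrow> exec c1 s t s' \<Longrightarrow>
    exec (Cond e c1 c2) s (Suc (cost e s + t)) s'"
| CondFalse: "eval_expr e s = DNil \<Longrightarrow> exec c2 s t s' \<Longrightarrow>
    exec (Cond e c1 c2) s (Suc (cost e s + t)) s'"
| WhileFalse: "eval_expr e s = DNil \<Longrightarrow> exec (While e c) s (Suc (cost e s)) s"
| WhileTrue: "eval_expr e s \<noteq> DNil \<Longrightarrow> exec c s t1 s1 \<Longrightarrow> exec (While e c) s1 t2 s2 \<Longrightarrow>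
    exec (While e c) s (Suc (cost e s + t1 + t2)) s2"

inductive_cases exec_AssignE: "exec (Assign x e) s t s'"
inductive_cases exec_SeqE: "exec (Seq c1 c2) s t s'"
inductive_cases exec_CondE: "exec (Cond e c1 c2) s t s'"
inductive_cases exec_WhileE: "exec (While e c) s t s'"

lemma exec_deterministic:
  "exec c s t s' \<Longrightarrow> exec c s u s'' \<Longrightarrow> t = u \<and> s' = s''"
proof (induction arbitrary: u s'' rule: exec.induct)
  case (Assign x e s)
  then show ?case by (auto elim: exec_AssignE)
next
  case (Seq c1 s t1 s1 c2 t2 s2)
  then show ?case by (blast elim: exec_SeqE)
next
  case (CondTrue e s c1 t s' c2)
  from CondTrue.prems obtain u' where "exec c1 s u' s''" "u = Suc (cost e s + u')"
    by (rule exec_CondE) (simp_all add: CondTrue.hyps(1))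
  with CondTrue.IH[of u' s''] show ?case by simp
next
  case (CondFalse e s c2 t s' c1)
  from CondFalse.prems obtain u' where "exec c2 s u' s''" "u = Suc (cost e s + u')"
    by (rule exec_CondE) (simp_all add: CondFalse.hyps(1))
  with CondFalse.IH[of u' s''] show ?case by simp
next
  case (WhileFalse e s c)
  from WhileFalse.prems show ?case
    by (rule exec_WhileE) (simp_all add: WhileFalse.hyps(1))
next
  case (WhileTrue e s c t1 s1 t2 s2)
  from WhileTrue.prems obtain u1 s1' u2 where u: "exec c s u1 s1'" "exec (While e c) s1' u2 s''"
      "u = Suc (cost e s + u1 + u2)"
    by (rule exec_WhileE) (simp_all add: WhileTrue.hyps(1))
  with WhileTrue.IH(1)[OF u(1)] WhileTrue.IH(2)[of u2 s''] show ?case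
    by simp
qed

text \<open>The input is placed in variable 0, all other variables are empty; the output is variable 0.\<close>

definition initial :: "data \<Rightarrow> store" where
  "initial d = (\<lambda>_. DNil)(0 := d)"

definition outputs :: "com \<Rightarrow> data \<Rightarrow> data \<Rightarrow> bool" where
  "outputs A d d' \<longleftrightarrow> (\<exists>t s. exec A (initial d) t s \<and> s 0 = d')"

definition polynomial_time :: "com \<Rightarrow> bool" where
  "polynomial_time A \<longleftrightarrow>
     (\<exists>a b. \<forall>d. \<exists>t s. exec A (initial d) t s \<and> t \<le> a * dsize d ^ b)"

section \<open>Representation of light forms and circuits as data\<close>

text \<open>Numbers are written in binary, least significant bit first.\<close>

fun enc_nat :: "nat \<Rightarrow> data" where
  "enc_nat m = (if m = 0 then DNil else DCons (of_bool_data (odd m)) (enc_nat (m div 2)))"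

declare enc_nat.simps [simp del]

lemma enc_nat_inject: "enc_nat a = enc_nat b \<longleftrightarrow> a = b"
proof (induction a arbitrary: b rule: less_induct)
  case (less a)
  have bit: "of_bool_data p = of_bool_data q \<longleftrightarrow> p = q" for p q
    by (cases p; cases q) auto
  show ?case
  proof (cases "a = 0 \<or> b = 0")
    case True
    then show ?thesis by (subst (1 2) enc_nat.simps) auto
  next
    case False
    then have "enc_nat a = enc_nat b \<longleftrightarrow> (odd a \<longleftrightarrow> odd b) \<and> a div 2 = b div 2"
      using less[of "a div 2" "b div 2"] by (subst (1 2) enc_nat.simps) (auto simp: bit)
    also have "\<dots> \<longleftrightarrow> a = b"
      by (metis even_two_times_div_two odd_two_times_div_two_succ)
    finally show ?thesis .
  qed
qed

fun enc_list :: "data list \<Rightarrow> data" where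
  "enc_list [] = DNil"
| "enc_list (d # ds) = DCons d (enc_list ds)"

lemma enc_list_inject: "enc_list ds = enc_list es \<longleftrightarrow> ds = es"
proof (induction ds arbitrary: es)
  case Nil
  then show ?case by (cases es) auto
next
  case (Cons d ds)
  then show ?case by (cases es) auto
qed

text \<open>
  Finite sets are represented by listing their elements without repetition in any order. The light
  form is the tuple of the nodes, the start node, the arcs (as triples tail, label, head), the sets
  of the parties \<open>1, \<dots>, k\<close>, and the terminal nodes with their labels.
\<close>

definition lists_set :: "'a list \<Rightarrow> 'a set \<Rightarrow> bool" where
  "lists_set xs A \<longleftrightarrow> distinct xs \<and> set xs = A"

definition represents_light_form :: "nat \<Rightarrow> data \<Rightarrow> light_form \<Rightarrow> bool" where
  "represents_light_form k d L \<longleftrightarrow>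
     (\<exists>vs es ps ts.
        lists_set vs (verts (dag L)) \<and> lists_set es (arcs (dag L)) \<and>
        list_all2 (\<lambda>p i. lists_set p (part L i)) ps [1..<Suc k] \<and> lists_set ts (terminals L) \<and>
        d = enc_list
          [enc_list (map enc_nat vs),
           enc_nat (start L),
           enc_list (map (\<lambda>e. enc_list [enc_nat (tail (dag L) e), of_bool_data (arc_label L e),
                                        enc_nat (head (dag L) e)]) es),
           enc_list (map (\<lambda>p. enc_list (map enc_nat p)) ps),
           enc_list (map (\<lambda>t. enc_list [enc_nat t, enc_nat (out_label L t)]) ts)])"

fun enc_gate :: "gate \<Rightarrow> data" where
  "enc_gate (Input i) = DCons (of_bool_data False) (enc_nat i)"
| "enc_gate (Thr vs) = DCons (of_bool_data True) (enc_list (map enc_nat vs))"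

definition represents_circuit :: "data \<Rightarrow> circuit \<Rightarrow> bool" where
  "represents_circuit d C \<longleftrightarrow>
     (\<exists>vs. lists_set vs (nodes C) \<and>
        d = enc_list
          [enc_nat (out C),
           enc_list (map (\<lambda>v. enc_list [enc_nat v, enc_gate (gate C v)]) vs)])"

end

theory Submission
  imports Defs
begin

text \<open>
  The proof rests on one property of protocols: a zero \<open>x\<close> of \<open>f\<close> which is \<open>i\<close>-compatible with
  a node remains so at the child chosen by its message if the node belongs to party \<open>i\<close>, and at both
  children otherwise.

  Cover the zeros by \<open>k\<close> (possibly overlapping) classes, and for every map \<open>\<alpha>\<close> from parties to
  classes run the protocol with party \<open>i\<close> playing an input of class \<open>\<alpha> i\<close>; a state is the tuple \<open>\<tau>\<close> of the
  \<open>k ^ k\<close> nodes reached. To move all these runs one step, split every class by the messages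
  at all nodes of \<open>\<tau>\<close>. This gives a constant number of subclasses, which are reduced to \<open>k\<close> again by
  threshold gates whose \<open>k + 1\<close> inputs each forget one of \<open>k + 1\<close> subclasses: for an input in one of the
  subclasses, only the wire that forgets it can carry 1. When the run of the identity
  reaches a terminal node \<open>t\<close>, every class has a party which is compatible with \<open>t\<close>, so the variable of \<open>t\<close> is 0
  on all classes. Initially each class consists of all zeros.
\<close>

section \<open>Polynomial time functions on binary trees\<close>

text \<open>A bound may depend on the whole tree and not only on its size. Expressions such as
  \<open>T (g d)\<close>, with \<open>g\<close> computed first, are then bounds themselves, and no
  monotonicity has to be carried along.\<close>

definition poly_bounded :: "(data \<Rightarrow> nat) \<Rightarrow> bool" where
  "poly_bounded T \<longleftrightarrow> (\<exists>a b. \<forall>d. T d \<le> a * dsize d ^ b)"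

lemma poly_boundedI: "(\<And>d. T d \<le> a * dsize d ^ b) \<Longrightarrow> poly_bounded T"
  by (auto simp: poly_bounded_def)

lemma dsize_ge_1: "1 \<le> dsize d"
  using dsize_pos[of d] by simp

lemma poly_bounded_mono: "poly_bounded T \<Longrightarrow> (\<And>d. U d \<le> T d) \<Longrightarrow> poly_bounded U"
  unfolding poly_bounded_def by (meson le_trans)

lemma poly_bounded_const: "poly_bounded (\<lambda>d. n)"
  by (rule poly_boundedI[of _ n 0]) simp

lemma poly_bounded_dsize: "poly_bounded dsize"
  by (rule poly_boundedI[of _ 1 1]) simp

lemma poly_bounded_add:
  assumes "poly_bounded T" "poly_bounded U"
  shows "poly_bounded (\<lambda>d. T d + U d)"
proof -
  obtain a b a' b' where T: "\<And>d. T d \<le> a * dsize d ^ b" and U: "\<And>d. U d \<le> a' * dsize d ^ b'"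
    using assms unfolding poly_bounded_def by blast
  show ?thesis
  proof (rule poly_boundedI)
    fix d :: data
    have "dsize d ^ b \<le> dsize d ^ (b + b')" "dsize d ^ b' \<le> dsize d ^ (b + b')"
      using dsize_ge_1[of d] by (auto intro: power_increasing)
    then have "a * dsize d ^ b + a' * dsize d ^ b' \<le> a * dsize d ^ (b + b') + a' * dsize d ^ (b + b')"
      by (intro add_mono mult_left_mono) auto
    then show "T d + U d \<le> (a + a') * dsize d ^ (b + b')"
      using T[of d] U[of d] by (simp add: algebra_simps)
  qed
qed

lemma poly_bounded_mult:
  assumes "poly_bounded T" "poly_bounded U"
  shows "poly_bounded (\<lambda>d. T d * U d)"
proof -
  obtain a b a' b' where T: "\<And>d. T d \<le> a * dsize d ^ b" and U: "\<And>d. U d \<le> a' * dsize d ^ b'"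
    using assms unfolding poly_bounded_def by blast
  show ?thesis
  proof (rule poly_boundedI)
    fix d :: data
    have "T d * U d \<le> (a * dsize d ^ b) * (a' * dsize d ^ b')"
      by (intro mult_mono T U) auto
    then show "T d * U d \<le> (a * a') * dsize d ^ (b + b')"
      by (simp add: power_add algebra_simps)
  qed
qed

lemma poly_bounded_power: "poly_bounded T \<Longrightarrow> poly_bounded (\<lambda>d. T d ^ n)"
  by (induction n) (auto intro: poly_bounded_const poly_bounded_mult)

lemma poly_bounded_compose:
  assumes "poly_bounded T" "poly_bounded (\<lambda>d. dsize (f d))"
  shows "poly_bounded (\<lambda>d. T (f d))"
proof -
  obtain a b where T: "\<And>d. T d \<le> a * dsize d ^ b"
    using assms(1) unfolding poly_bounded_def by blast
  have "poly_bounded (\<lambda>d. a * dsize (f d) ^ b)"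
    using assms(2) by (intro poly_bounded_mult poly_bounded_const poly_bounded_power)
  then show ?thesis
    by (rule poly_bounded_mono) (rule T)
qed

lemmas poly_bounded_intros =
  poly_bounded_const poly_bounded_dsize poly_bounded_add poly_bounded_mult poly_bounded_power

text \<open>Evaluating an expression costs at least the size of its value, so a variable cannot
  outgrow the time spent. This turns time bounds into size bounds.\<close>

lemma exec_dsize_le: "exec c s t s' \<Longrightarrow> dsize (s' x) \<le> dsize (s x) + t"
proof (induction rule: exec.induct)
  case (Assign y e s)
  then show ?case using dsize_eval_le[of e s] by auto
qed auto

text \<open>
  The programs work on a stack: with frame pointer \<open>m\<close>, a program reads its argument from variable
  \<open>m\<close>, leaves its result there, and may overwrite all variables above \<open>m\<close>, whose initial contents it
  must not depend on.
\<close>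

definition ptime :: "(data \<Rightarrow> data) \<Rightarrow> bool" where
  "ptime f \<longleftrightarrow> (\<exists>c T. poly_bounded T \<and>
     (\<forall>m s. \<exists>t s'. exec (c m) s t s' \<and> t \<le> T (s m) \<and> s' m = f (s m) \<and> (\<forall>x<m. s' x = s x)))"

lemma ptimeI:
  assumes "poly_bounded T"
    and "\<And>m s. \<exists>t s'. exec (c m) s t s' \<and> t \<le> T (s m) \<and> s' m = f (s m) \<and> (\<forall>x<m. s' x = s x)"
  shows "ptime f"
  using assms unfolding ptime_def by blast

lemma ptimeE:
  assumes "ptime f"
  obtains c T where "poly_bounded T"
    and "\<And>m s. \<exists>t s'. exec (c m) s t s' \<and> t \<le> T (s m) \<and> s' m = f (s m) \<and> (\<forall>x<m. s' x = s x)"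
  using assms unfolding ptime_def by blast

text \<open>The result is written by the program, hence its size is at most input size plus time.
  Composition needs this, since the second program is charged for the output of the first.\<close>

lemma ptime_dsize:
  assumes "ptime f"
  shows "poly_bounded (\<lambda>d. dsize (f d))"
proof -
  obtain c T where T: "poly_bounded T"
    and c: "\<And>m s. \<exists>t s'. exec (c m) s t s' \<and> t \<le> T (s m) \<and> s' m = f (s m) \<and> (\<forall>x<m. s' x = s x)"
    by (rule ptimeE[OF assms]) blast
  have "poly_bounded (\<lambda>d. dsize d + T d)"
    by (intro poly_bounded_intros T)
  then show ?thesis
  proof (rule poly_bounded_mono)
    fix d :: data
    obtain t s' where "exec (c 0) (\<lambda>_. d) t s'" "t \<le> T d" "s' 0 = f d"
      using c[of 0 "\<lambda>_. d"] by auto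
    then show "dsize (f d) \<le> dsize d + T d"
      using exec_dsize_le[of "c 0" "\<lambda>_. d" t s' 0] by simp
  qed
qed

lemma polynomial_time_of_ptime:
  assumes "ptime f"
  shows "\<exists>A. polynomial_time A \<and> (\<forall>d. outputs A d (f d))"
proof -
  obtain c T where T: "poly_bounded T"
    and c: "\<And>m s. \<exists>t s'. exec (c m) s t s' \<and> t \<le> T (s m) \<and> s' m = f (s m) \<and> (\<forall>x<m. s' x = s x)"
    by (rule ptimeE[OF assms]) blast
  have run: "\<exists>t s'. exec (c 0) (initial d) t s' \<and> t \<le> T d \<and> s' 0 = f d" for d
    using c[of 0 "initial d"] by (auto simp: initial_def)
  obtain a b where "\<And>d. T d \<le> a * dsize d ^ b"
    using T unfolding poly_bounded_def by blast
  then have "polynomial_time (c 0)"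
    unfolding polynomial_time_def using run by (meson le_trans)
  moreover have "\<forall>d. outputs (c 0) d (f d)"
    unfolding outputs_def using run by blast
  ultimately show ?thesis by blast
qed

section \<open>Closure properties of polynomial-time functions\<close>

lemma ptime_id: "ptime (\<lambda>d. d)"
proof (rule ptimeI)
  show "poly_bounded (\<lambda>d. Suc (dsize d))"
    using poly_bounded_add[OF poly_bounded_const[of 1] poly_bounded_dsize] by simp
  show "\<exists>t s'. exec (Assign m (Var m)) s t s' \<and> t \<le> Suc (dsize (s m)) \<and> s' m = s m \<and>
    (\<forall>x<m. s' x = s x)" for m s
    using exec.Assign[of m "Var m" s] by auto
qed

lemma ptime_Nil: "ptime (\<lambda>d. DNil)"
proof (rule ptimeI)
  show "poly_bounded (\<lambda>d. 2)" by (rule poly_bounded_const)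
  show "\<exists>t s'. exec (Assign m Nil_E) s t s' \<and> t \<le> 2 \<and> s' m = DNil \<and>
    (\<forall>x<m. s' x = s x)" for m s
    using exec.Assign[of m "Nil_E" s] by fastforce
qed

lemma ptime_compose:
  assumes "ptime f" "ptime g"
  shows "ptime (\<lambda>d. f (g d))"
proof -
  obtain c T where T: "poly_bounded T"
    and c: "\<And>m s. \<exists>t s'. exec (c m) s t s' \<and> t \<le> T (s m) \<and> s' m = f (s m) \<and> (\<forall>x<m. s' x = s x)"
    by (rule ptimeE[OF assms(1)]) blast
  obtain c' T' where T': "poly_bounded T'"
    and c': "\<And>m s. \<exists>t s'. exec (c' m) s t s' \<and> t \<le> T' (s m) \<and> s' m = g (s m) \<and> (\<forall>x<m. s' x = s x)"
    by (rule ptimeE[OF assms(2)]) blast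
  show ?thesis
  proof (rule ptimeI)
    show "poly_bounded (\<lambda>d. T' d + T (g d))"
      by (intro poly_bounded_intros T' poly_bounded_compose[OF T] ptime_dsize assms)
    fix m :: nat and s :: store
    obtain t1 s1 where 1: "exec (c' m) s t1 s1" "t1 \<le> T' (s m)" "s1 m = g (s m)" "\<forall>x<m. s1 x = s x"
      using c' by blast
    obtain t2 s2 where 2: "exec (c m) s1 t2 s2" "t2 \<le> T (s1 m)" "s2 m = f (s1 m)" "\<forall>x<m. s2 x = s1 x"
      using c by blast
    show "\<exists>t s'. exec (Seq (c' m) (c m)) s t s' \<and> t \<le> T' (s m) + T (g (s m)) \<and> s' m = f (g (s m)) \<and>
      (\<forall>x<m. s' x = s x)"
      using exec.Seq[OF 1(1) 2(1)] 1 2 by (intro exI[of _ "t1 + t2"] exI[of _ s2]) auto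
  qed
qed

lemma ptime_hd_raw: "ptime dhd"
proof (rule ptimeI)
  show "poly_bounded (\<lambda>d. 2 + dsize d)" by (intro poly_bounded_intros)
  show "\<exists>t s'. exec (Assign m (Hd_E (Var m))) s t s' \<and> t \<le> 2 + dsize (s m) \<and> s' m = dhd (s m) \<and>
    (\<forall>x<m. s' x = s x)" for m s
    using exec.Assign[of m "Hd_E (Var m)" s] by fastforce
qed

lemma ptime_tl_raw: "ptime dtl"
proof (rule ptimeI)
  show "poly_bounded (\<lambda>d. 2 + dsize d)" by (intro poly_bounded_intros)
  show "\<exists>t s'. exec (Assign m (Tl_E (Var m))) s t s' \<and> t \<le> 2 + dsize (s m) \<and> s' m = dtl (s m) \<and>
    (\<forall>x<m. s' x = s x)" for m s
    using exec.Assign[of m "Tl_E (Var m)" s] by fastforce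
qed

lemmas ptime_hd = ptime_compose[OF ptime_hd_raw]
lemmas ptime_tl = ptime_compose[OF ptime_tl_raw]

text \<open>The argument stays in variable \<open>m\<close>; the first value is computed in frame
  \<open>m + 1\<close> and the second in frame \<open>m + 2\<close>, which leaves everything below
  intact. The abstract \<open>op\<close> covers both \<open>Cons_E\<close> and
  \<open>Eq_E\<close>.\<close>

lemma ptime_binary_expr:
  assumes f: "ptime f" and g: "ptime g"
    and h: "\<And>x y s. eval_expr (op (Var x) (Var y)) s = h (s x) (s y)"
    and cost: "\<And>x y s. cost (op (Var x) (Var y)) s = Suc (dsize (s x) + dsize (s y))"
  shows "ptime (\<lambda>d. h (f d) (g d))"
proof -
  obtain c T where T: "poly_bounded T"
    and c: "\<And>m s. \<exists>t s'. exec (c m) s t s' \<and> t \<le> T (s m) \<and> s' m = f (s m) \<and> (\<forall>x<m. s' x = s x)"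
    by (rule ptimeE[OF f]) blast
  obtain c' T' where T': "poly_bounded T'"
    and c': "\<And>m s. \<exists>t s'. exec (c' m) s t s' \<and> t \<le> T' (s m) \<and> s' m = g (s m) \<and> (\<forall>x<m. s' x = s x)"
    by (rule ptimeE[OF g]) blast
  define P where "P m = Seq (Assign (m + 1) (Var m)) (Seq (c (m + 1)) (Seq (Assign (m + 2) (Var m))
    (Seq (c' (m + 2)) (Assign m (op (Var (m + 1)) (Var (m + 2)))))))" for m
  show ?thesis
  proof (rule ptimeI)
    show "poly_bounded (\<lambda>d. 4 + 2 * dsize d + T d + T' d + dsize (f d) + dsize (g d))"
      by (intro poly_bounded_intros T T' ptime_dsize f g)
    fix m :: nat and s :: store
    define s0 where "s0 = s(m + 1 := s m)"
    have 0: "exec (Assign (m + 1) (Var m)) s (Suc (dsize (s m))) s0"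
      using exec.Assign[of "m + 1" "Var m" s] by (simp add: s0_def)
    obtain t1 s1 where 1: "exec (c (m + 1)) s0 t1 s1" "t1 \<le> T (s m)" "s1 (m + 1) = f (s m)"
        "\<forall>x<m+1. s1 x = s x"
      using c[of "m + 1" s0] by (auto simp: s0_def)
    define s2 where "s2 = s1(m + 2 := s m)"
    have 2: "exec (Assign (m + 2) (Var m)) s1 (Suc (dsize (s m))) s2"
      using exec.Assign[of "m + 2" "Var m" s1] 1 by (simp add: s2_def)
    obtain t3 s3 where 3: "exec (c' (m + 2)) s2 t3 s3" "t3 \<le> T' (s m)" "s3 (m + 2) = g (s m)"
        "\<forall>x<m+2. s3 x = s1 x"
      using c'[of "m + 2" s2] 1 by (auto simp: s2_def)
    have 4: "exec (Assign m (op (Var (m + 1)) (Var (m + 2)))) s3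
       (Suc (Suc (dsize (f (s m)) + dsize (g (s m))))) (s3(m := h (f (s m)) (g (s m))))"
      using exec.Assign[of m "op (Var (m + 1)) (Var (m + 2))" s3] 1 3 by (simp add: h cost)
    have run: "exec (P m) s (Suc (dsize (s m)) + (t1 + (Suc (dsize (s m)) + (t3 +
       (Suc (Suc (dsize (f (s m)) + dsize (g (s m)))))))))
       (s3(m := h (f (s m)) (g (s m))))"
      unfolding P_def by (rule exec.Seq[OF 0 exec.Seq[OF 1(1) exec.Seq[OF 2 exec.Seq[OF 3(1) 4]]]])
    show "\<exists>t s'. exec (P m) s t s' \<and>
        t \<le> 4 + 2 * dsize (s m) + T (s m) + T' (s m) + dsize (f (s m)) + dsize (g (s m)) \<and>
        s' m = h (f (s m)) (g (s m)) \<and> (\<forall>x<m. s' x = s x)"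
      by (rule exI, rule exI, rule conjI, rule run) (use 1 3 in auto)
  qed
qed

lemma ptime_Cons: "ptime f \<Longrightarrow> ptime g \<Longrightarrow> ptime (\<lambda>d. DCons (f d) (g d))"
  by (rule ptime_binary_expr[where op = Cons_E]) auto

lemma ptime_eq: "ptime f \<Longrightarrow> ptime g \<Longrightarrow> ptime (\<lambda>d. of_bool_data (f d = g d))"
  by (rule ptime_binary_expr[where op = Eq_E]) auto

lemma ptime_const: "ptime (\<lambda>d. e)"
  by (induction e) (auto intro: ptime_Nil ptime_Cons)

lemma ptime_if:
  assumes p: "ptime p" and f: "ptime f" and g: "ptime g"
  shows "ptime (\<lambda>d. if p d = DNil then g d else f d)"
proof -
  obtain c T where T: "poly_bounded T"
    and c: "\<And>m s. \<exists>t s'. exec (c m) s t s' \<and> t \<le> T (s m) \<and> s' m = f (s m) \<and> (\<forall>x<m. s' x = s x)"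
    by (rule ptimeE[OF f]) blast
  obtain c' T' where T': "poly_bounded T'"
    and c': "\<And>m s. \<exists>t s'. exec (c' m) s t s' \<and> t \<le> T' (s m) \<and> s' m = g (s m) \<and> (\<forall>x<m. s' x = s x)"
    by (rule ptimeE[OF g]) blast
  obtain cp U where U: "poly_bounded U"
    and cp: "\<And>m s. \<exists>t s'. exec (cp m) s t s' \<and> t \<le> U (s m) \<and> s' m = p (s m) \<and> (\<forall>x<m. s' x = s x)"
    by (rule ptimeE[OF p]) blast
  define P where "P m = Seq (Assign (m + 1) (Var m)) (Seq (cp (m + 1))
    (Cond (Var (m + 1)) (c m) (c' m)))" for m
  show ?thesis
  proof (rule ptimeI)
    show "poly_bounded (\<lambda>d. 2 + dsize d + U d + dsize (p d) + T d + T' d)"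
      by (intro poly_bounded_intros T T' U ptime_dsize p)
    fix m :: nat and s :: store
    define s0 where "s0 = s(m + 1 := s m)"
    have 0: "exec (Assign (m + 1) (Var m)) s (Suc (dsize (s m))) s0"
      using exec.Assign[of "m + 1" "Var m" s] by (simp add: s0_def)
    obtain t1 s1 where 1: "exec (cp (m + 1)) s0 t1 s1" "t1 \<le> U (s m)" "s1 (m + 1) = p (s m)"
        "\<forall>x<m+1. s1 x = s x"
      using cp[of "m + 1" s0] by (auto simp: s0_def)
    show "\<exists>t s'. exec (P m) s t s' \<and>
        t \<le> 2 + dsize (s m) + U (s m) + dsize (p (s m)) + T (s m) + T' (s m) \<and>
        s' m = (if p (s m) = DNil then g (s m) else f (s m)) \<and> (\<forall>x<m. s' x = s x)"
    proof (cases "p (s m) = DNil")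
      case True
      obtain t2 s2 where 2: "exec (c' m) s1 t2 s2" "t2 \<le> T' (s m)" "s2 m = g (s m)"
        "\<forall>x<m. s2 x = s x"
        using c'[of m s1] 1 by auto
      have "exec (Cond (Var (m + 1)) (c m) (c' m)) s1 (Suc (cost (Var (m + 1)) s1 + t2)) s2"
        using 1 True by (intro exec.CondFalse 2) auto
      from exec.Seq[OF 0 exec.Seq[OF 1(1) this]] have run: "exec (P m) s (Suc (dsize (s m)) + (t1 + Suc (cost (Var (m + 1)) s1 + t2))) s2"
        unfolding P_def .
      show ?thesis
        by (rule exI, rule exI, rule conjI, rule run) (use 1 2 True in auto)
    next
      case False
      obtain t2 s2 where 2: "exec (c m) s1 t2 s2" "t2 \<le> T (s m)" "s2 m = f (s m)"
        "\<forall>x<m. s2 x = s x"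
        using c[of m s1] 1 by auto
      have "exec (Cond (Var (m + 1)) (c m) (c' m)) s1 (Suc (cost (Var (m + 1)) s1 + t2)) s2"
        using 1 False by (intro exec.CondTrue 2) auto
      from exec.Seq[OF 0 exec.Seq[OF 1(1) this]] have run: "exec (P m) s (Suc (dsize (s m)) + (t1 + Suc (cost (Var (m + 1)) s1 + t2))) s2"
        unfolding P_def .
      show ?thesis
        by (rule exI, rule exI, rule conjI, rule run) (use 1 2 False in auto)
    qed
  qed
qed

subsection \<open>Folding over a list\<close>

text \<open>The argument \<open>e\<close> is an environment: a loop body is a program without free
  data parameters, so whatever it needs besides the list entry and the accumulator must be handed to
  it.\<close>

fun dfold :: "(data \<Rightarrow> data \<Rightarrow> data \<Rightarrow> data) \<Rightarrow> data \<Rightarrow> data \<Rightarrow> data \<Rightarrow> data" where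
  "dfold F e DNil a = a"
| "dfold F e (DCons x l) a = dfold F e l (F e x a)"

text \<open>Variables \<open>m\<close>, \<open>m + 1\<close>, \<open>m + 2\<close> hold environment,
  remaining list and accumulator; the body runs in frame \<open>m + 3\<close>. The number
  \<open>W\<close> bounds their sizes together with a reserve of \<open>g\<close> for each unit of
  size of the remaining list, so it bounds the store in every round.\<close>

lemma exec_dfold:
  assumes exec_F: "\<And>s. \<exists>t s'. exec cF s t s' \<and> t \<le> A * dsize (s (m + 3)) ^ B \<and>
      s' (m + 3) = F (dhd (s (m + 3))) (dhd (dtl (s (m + 3)))) (dtl (dtl (s (m + 3)))) \<and>
      (\<forall>x<m+3. s' x = s x)"
    and growth: "\<And>x a. dsize x \<le> n \<Longrightarrow> dsize (F e x a) \<le> dsize a + g"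
    and "dsize l \<le> n" "dsize e + dsize l + dsize a + dsize l * g \<le> W"
    and "s m = e" "s (m + 1) = l" "s (m + 2) = a"
  shows "\<exists>t s'. exec (While (Var (m + 1))
       (Seq (Assign (m + 3) (Cons_E (Var m) (Cons_E (Hd_E (Var (m + 1))) (Var (m + 2)))))
       (Seq cF (Seq (Assign (m + 2) (Var (m + 3))) (Assign (m + 1) (Tl_E (Var (m + 1)))))))) s t s' \<and>
     t \<le> dsize l * (A * (W + 2) ^ B + 5 * W + 20) \<and> s' (m + 2) = dfold F e l a \<and> (\<forall>x<m. s' x = s x)"
    (is "\<exists>t s'. exec ?P s t s' \<and> _")
  using assms(3-)
proof (induction l arbitrary: a s)
  case DNil
  have run: "exec ?P s (Suc (cost (Var (m + 1)) s)) s"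
    using DNil by (intro exec.WhileFalse) auto
  show ?case
    by (rule exI, rule exI, rule conjI, rule run) (use DNil in auto)
next
  case (DCons x l)
  define u where "u = DCons e (DCons x a)"
  have u: "dsize u \<le> W + 2"
    using DCons.prems by (simp add: u_def)
  define s0 where "s0 = s(m + 3 := u)"
  have 0: "exec (Assign (m + 3) (Cons_E (Var m) (Cons_E (Hd_E (Var (m + 1))) (Var (m + 2))))) s
      (dsize e + dsize x + dsize l + dsize a + 5) s0"
    using exec.Assign[of "m + 3" "Cons_E (Var m) (Cons_E (Hd_E (Var (m + 1))) (Var (m + 2)))" s]
      DCons.prems by (simp add: eval_nat_numeral s0_def u_def add.assoc)
  obtain t1 s1 where 1: "exec cF s0 t1 s1" "t1 \<le> A * dsize u ^ B" "s1 (m + 3) = F e x a"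
      "\<forall>y<m+3. s1 y = s0 y"
    using exec_F[of s0] by (auto simp: s0_def u_def)
  define s2 where "s2 = s1(m + 2 := F e x a)"
  have 2: "exec (Assign (m + 2) (Var (m + 3))) s1 (Suc (dsize (F e x a))) s2"
    using exec.Assign[of "m + 2" "Var (m + 3)" s1] 1 by (simp add: s2_def)
  define s3 where "s3 = s2(m + 1 := l)"
  have s2: "s2 (m + 1) = DCons x l"
    using 1 DCons.prems by (simp add: s2_def s0_def)
  then have 3: "exec (Assign (m + 1) (Tl_E (Var (m + 1)))) s2 (dsize x + dsize l + 3) s3"
    using exec.Assign[of "m + 1" "Tl_E (Var (m + 1))" s2] by (simp add: eval_nat_numeral s3_def)
  have grow: "dsize (F e x a) \<le> dsize a + g"
    using DCons.prems by (intro growth) auto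
  \<comment> \<open>Removing \<open>x\<close> from the list releases at least \<open>g\<close> from
    the reserve, which pays for the growth of the accumulator.\<close>
  have W: "dsize e + dsize l + dsize (F e x a) + dsize l * g \<le> W"
    using DCons.prems grow by (simp add: algebra_simps)
  have s3: "s3 m = e" "s3 (m + 1) = l" "s3 (m + 2) = F e x a" "\<forall>y<m. s3 y = s y"
    using 1 DCons.prems by (auto simp: s3_def s2_def s0_def)
  obtain t4 s4 where 4: "exec ?P s3 t4 s4" "t4 \<le> dsize l * (A * (W + 2) ^ B + 5 * W + 20)"
     "s4 (m + 2) = dfold F e l (F e x a)" "\<forall>y<m. s4 y = s3 y"
    using DCons.IH[of "F e x a" s3] W s3 DCons.prems by auto
  have run: "exec ?P s (Suc (cost (Var (m + 1)) s +
      ((dsize e + dsize x + dsize l + dsize a + 5) + (t1 + (Suc (dsize (F e x a)) + (dsize x + dsize l + 3)))) + t4)) s4"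
    by (rule exec.WhileTrue[OF _ exec.Seq[OF 0 exec.Seq[OF 1(1) exec.Seq[OF 2 3]]] 4(1)])
      (use DCons.prems in auto)
  have "A * dsize u ^ B \<le> A * (W + 2) ^ B"
    using u by (intro mult_left_mono power_mono) auto
  moreover have "dsize e + dsize x + dsize l + dsize a \<le> W" "dsize (F e x a) \<le> W"
      "cost (Var (m + 1)) s = Suc (dsize x + dsize l)"
    using DCons.prems W by auto
  moreover define X where "X = A * (W + 2) ^ B"
  moreover define Y where "Y = dsize l * (X + 5 * W + 20)"
  ultimately have t: "Suc (cost (Var (m + 1)) s +
      ((dsize e + dsize x + dsize l + dsize a + 5) + (t1 + (Suc (dsize (F e x a)) + (dsize x + dsize l + 3)))) + t4)
      \<le> (X + 5 * W + 20) + Y" (is "?t \<le> _")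
    using 1(2) 4(2) unfolding X_def[symmetric] Y_def[symmetric] by linarith
  also have "\<dots> \<le> dsize (DCons x l) * (A * (W + 2) ^ B + 5 * W + 20)"
    by (simp add: Y_def X_def algebra_simps)
  finally have "?t \<le> dsize (DCons x l) * (A * (W + 2) ^ B + 5 * W + 20)" .
  with run show ?case
    using 4(3,4) s3(4) by (intro exI[of _ ?t] exI[of _ s4]) (simp del: dsize.simps cost.simps)
qed

text \<open>The growth bound must not depend on the accumulator: a body that doubles it would give
  exponential size. Additive growth adds up to a polynomial over the list.\<close>

lemma ptime_dfold:
  assumes F: "ptime (\<lambda>d. F (dhd d) (dhd (dtl d)) (dtl (dtl d)))"
    and growth: "\<And>e x a. dsize (F e x a) \<le> dsize a + G (DCons e x)" and G: "poly_bounded G"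
    and f1: "ptime f1" and f2: "ptime f2" and f3: "ptime f3"
  shows "ptime (\<lambda>d. dfold F (f1 d) (f2 d) (f3 d))"
proof -
  obtain cF T where T: "poly_bounded T"
    and cF: "\<And>m s. \<exists>t s'. exec (cF m) s t s' \<and> t \<le> T (s m) \<and>
      s' m = F (dhd (s m)) (dhd (dtl (s m))) (dtl (dtl (s m))) \<and> (\<forall>x<m. s' x = s x)"
    by (rule ptimeE[OF F]) blast
  obtain A B where AB: "\<And>d. T d \<le> A * dsize d ^ B"
    using T unfolding poly_bounded_def by blast
  obtain g1 g2 where g: "\<And>d. G d \<le> g1 * dsize d ^ g2"
    using G unfolding poly_bounded_def by blast
  \<comment> \<open>Here \<open>2 * n + 1\<close> bounds the size of \<open>DCons e x\<close>. The
    function is used at \<open>3 * dsize d\<close>, because \<open>e\<close>, \<open>l\<close> and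
    \<open>a\<close> each have size at most \<open>dsize d\<close>.\<close>
  define W where "W n = n + n * (g1 * (2 * n + 1) ^ g2)" for n :: nat
  \<comment> \<open>Variable \<open>m\<close> is overwritten last, as it holds the argument from
    which all three parts are read.\<close>
  define P where "P m = Seq (Assign (m + 1) (Hd_E (Tl_E (Var m))))
    (Seq (Assign (m + 2) (Tl_E (Tl_E (Var m)))) (Seq (Assign m (Hd_E (Var m)))
    (Seq (While (Var (m + 1))
       (Seq (Assign (m + 3) (Cons_E (Var m) (Cons_E (Hd_E (Var (m + 1))) (Var (m + 2)))))
       (Seq (cF (m + 3)) (Seq (Assign (m + 2) (Var (m + 3))) (Assign (m + 1) (Tl_E (Var (m + 1))))))))
    (Assign m (Var (m + 2))))))" for m
  have main: "ptime (\<lambda>d. dfold F (dhd d) (dhd (dtl d)) (dtl (dtl d)))"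
  proof (rule ptimeI)
    have W: "poly_bounded (\<lambda>d. W (3 * dsize d))"
      unfolding W_def by (intro poly_bounded_intros)
    show "poly_bounded (\<lambda>d. 11 + 4 * dsize d +
        2 * (dsize d * (A * (W (3 * dsize d) + 2) ^ B + 5 * W (3 * dsize d) + 20)))"
      by (intro poly_bounded_intros W)
    fix m :: nat and s :: store
    define d where "d = s m"
    define e l a where "e = dhd d" and "l = dhd (dtl d)" and "a = dtl (dtl d)"
    have tl_le: "dsize (dtl x) \<le> dsize x" and hd_le: "dsize (dhd x) \<le> dsize x" for x
      by (cases x; simp)+
    have sizes: "dsize e \<le> dsize d" "dsize l \<le> dsize d" "dsize a \<le> dsize d"
      unfolding e_def l_def a_def using tl_le hd_le by (meson le_trans)+
    define n where "n = dsize d"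
    define s1 where "s1 = s(m + 1 := l)"
    define s2 where "s2 = s1(m + 2 := a)"
    define s3 where "s3 = s2(m := e)"
    have 1: "exec (Assign (m + 1) (Hd_E (Tl_E (Var m)))) s (dsize d + 3) s1"
      using exec.Assign[of "m + 1" "Hd_E (Tl_E (Var m))" s] by (simp add: eval_nat_numeral s1_def l_def d_def)
    have 2: "exec (Assign (m + 2) (Tl_E (Tl_E (Var m)))) s1 (dsize d + 3) s2"
      using exec.Assign[of "m + 2" "Tl_E (Tl_E (Var m))" s1] by (simp add: eval_nat_numeral s1_def s2_def a_def d_def)
    have 3: "exec (Assign m (Hd_E (Var m))) s2 (dsize d + 2) s3"
      using exec.Assign[of m "Hd_E (Var m)" s2] by (simp add: eval_nat_numeral s1_def s2_def s3_def e_def d_def)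
    define g where "g = g1 * (2 * n + 1) ^ g2"
    have growth': "dsize (F e x b) \<le> dsize b + g" if "dsize x \<le> n" for x b
    proof -
      have "dsize (DCons e x) \<le> 2 * n + 1"
        using that sizes by (simp add: n_def)
      then have "g1 * dsize (DCons e x) ^ g2 \<le> g"
        unfolding g_def by (intro mult_left_mono power_mono) auto
      then show ?thesis
        using growth[of e x b] g[of "DCons e x"] by linarith
    qed
    have "dsize l * g \<le> 3 * n * (g1 * (2 * (3 * n) + 1) ^ g2)"
      unfolding g_def using sizes by (intro mult_mono power_mono) (auto simp: n_def)
    then have W_le: "dsize e + dsize l + dsize a + dsize l * g \<le> W (3 * n)"
      unfolding W_def using sizes by (simp add: n_def)
    have cF': "\<exists>t s'. exec (cF (m + 3)) s t s' \<and> t \<le> A * dsize (s (m + 3)) ^ B \<and>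
      s' (m + 3) = F (dhd (s (m + 3))) (dhd (dtl (s (m + 3)))) (dtl (dtl (s (m + 3)))) \<and>
      (\<forall>x<m+3. s' x = s x)" for s
      using cF[of "m + 3" s] AB[of "s (m + 3)"] by (meson le_trans)
    obtain t4 s4 where 4: "exec (While (Var (m + 1))
       (Seq (Assign (m + 3) (Cons_E (Var m) (Cons_E (Hd_E (Var (m + 1))) (Var (m + 2)))))
       (Seq (cF (m + 3)) (Seq (Assign (m + 2) (Var (m + 3))) (Assign (m + 1) (Tl_E (Var (m + 1)))))))) s3 t4 s4"
      and t4: "t4 \<le> dsize l * (A * (W (3 * n) + 2) ^ B + 5 * W (3 * n) + 20)"
      and s4: "s4 (m + 2) = dfold F e l a" "\<forall>x<m. s4 x = s3 x"
      using exec_dfold[where F = F and A = A and B = B and m = m and n = n and g = g and e = e and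
          a = a and l = l and s = s3, OF cF' growth' _ W_le] sizes
      by (auto simp: n_def s3_def s2_def s1_def)
    have 5: "exec (Assign m (Var (m + 2))) s4 (Suc (dsize (dfold F e l a))) (s4(m := dfold F e l a))"
      using exec.Assign[of m "Var (m + 2)" s4] s4 by simp
    have "dsize (dfold F e l a) \<le> dsize a + t4"
      using exec_dsize_le[OF 4, of "m + 2"] s4 by (simp add: s3_def s2_def)
    moreover have "t4 \<le> dsize d * (A * (W (3 * n) + 2) ^ B + 5 * W (3 * n) + 20)"
      using t4 sizes by (meson le_trans mult_le_mono1)
    moreover have "exec (P m) s ((dsize d + 3) + ((dsize d + 3) + ((dsize d + 2) + (t4 + Suc (dsize (dfold F e l a))))))
        (s4(m := dfold F e l a))"
      unfolding P_def by (rule exec.Seq[OF 1 exec.Seq[OF 2 exec.Seq[OF 3 exec.Seq[OF 4 5]]]])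
    ultimately show "\<exists>t s'. exec (P m) s t s' \<and> t \<le> 11 + 4 * dsize (s m) +
        2 * (dsize (s m) * (A * (W (3 * dsize (s m)) + 2) ^ B + 5 * W (3 * dsize (s m)) + 20)) \<and>
        s' m = dfold F (dhd (s m)) (dhd (dtl (s m))) (dtl (dtl (s m))) \<and> (\<forall>x<m. s' x = s x)"
      using sizes s4
      by (intro exI[of _ "(dsize d + 3) + ((dsize d + 3) + ((dsize d + 2) + (t4 + Suc (dsize (dfold F e l a)))))"]
          exI[of _ "s4(m := dfold F e l a)"])
        (auto simp: e_def l_def a_def d_def n_def s3_def s2_def s1_def)
  qed
  have "ptime (\<lambda>d. DCons (f1 d) (DCons (f2 d) (f3 d)))"
    by (intro ptime_Cons f1 f2 f3)
  from ptime_compose[OF main this] show ?thesis by simp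
qed

subsection \<open>Operations on lists\<close>

abbreviation "dFalse \<equiv> of_bool_data False"
abbreviation "dTrue \<equiv> of_bool_data True"

lemma of_bool_data_eq_iff: "of_bool_data p = of_bool_data q \<longleftrightarrow> p = q"
  by (cases p; cases q) auto

lemma ptime_If_eq:
  assumes "ptime f" "ptime g" "ptime h" "ptime h'"
  shows "ptime (\<lambda>d. if f d = g d then h d else h' d)"
proof -
  have "ptime (\<lambda>d. if of_bool_data (f d = g d) = DNil then h' d else h d)"
    by (intro ptime_if ptime_eq assms)
  moreover have "(if of_bool_data (f d = g d) = DNil then h' d else h d) =
      (if f d = g d then h d else h' d)" for d
    by auto
  ultimately show ?thesis by simp
qed

definition drev :: "data \<Rightarrow> data" where
  "drev l = dfold (\<lambda>e x a. DCons x a) DNil l DNil"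

definition dappend :: "data \<Rightarrow> data \<Rightarrow> data" where
  "dappend l l' = dfold (\<lambda>e x a. DCons x a) DNil (drev l) l'"

definition dconcat_map :: "(data \<Rightarrow> data \<Rightarrow> data) \<Rightarrow> data \<Rightarrow> data \<Rightarrow> data" where
  "dconcat_map G e l = dfold (\<lambda>e x a. dappend (G e x) a) e (drev l) DNil"

text \<open>The last matching entry wins, and \<open>DNil\<close> signals that no key matches. Where
  absence has to be recognised, \<open>R\<close> is chosen with values different from
  \<open>DNil\<close>.\<close>

definition dlookup :: "(data \<Rightarrow> data) \<Rightarrow> (data \<Rightarrow> data) \<Rightarrow> data \<Rightarrow> data \<Rightarrow> data" where
  "dlookup K R e l = dfold (\<lambda>e x a. if K x = e then R x else a) e l DNil"

lemma dfold_enc_list: "dfold F e (enc_list xs) a = fold (F e) xs a"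
  by (induction xs arbitrary: a) auto

lemma fold_DCons: "fold DCons xs (enc_list ys) = enc_list (rev xs @ ys)"
  by (induction xs arbitrary: ys) (auto simp flip: enc_list.simps(2))

lemma drev_enc_list: "drev (enc_list xs) = enc_list (rev xs)"
  unfolding drev_def dfold_enc_list using fold_DCons[of xs "[]"] by simp

lemma dappend_enc_list: "dappend (enc_list xs) (enc_list ys) = enc_list (xs @ ys)"
  by (simp add: dappend_def drev_enc_list dfold_enc_list fold_DCons)

lemma dconcat_map_enc_list:
  assumes "\<And>x. x \<in> set xs \<Longrightarrow> G e (f x) = enc_list (g x)"
  shows "dconcat_map G e (enc_list (map f xs)) = enc_list (concat (map g xs))"
proof -
  have "fold (\<lambda>x. dappend (G e x)) (rev (map f xs)) DNil = enc_list (concat (map g xs))"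
    using assms
  proof (induction xs)
    case (Cons x xs)
    then show ?case by (simp add: dappend_enc_list)
  qed simp
  then show ?thesis
    by (simp add: dconcat_map_def drev_enc_list dfold_enc_list)
qed

lemma dlookup_enc_list:
  assumes "x \<in> set xs" "K x = e" "\<And>y. y \<in> set xs \<Longrightarrow> K y = e \<Longrightarrow> R y = r"
  shows "dlookup K R e (enc_list xs) = r"
proof -
  have keep: "fold (\<lambda>x a. if K x = e then R x else a) ys r = r" if "set ys \<subseteq> set xs" for ys
    using that assms(3) by (induction ys) auto
  have "fold (\<lambda>x a. if K x = e then R x else a) ys a = r"
    if "x \<in> set ys" "set ys \<subseteq> set xs" for ys a
    using that
  proof (induction ys arbitrary: a)
    case (Cons y ys)
    then show ?case
      using keep[of ys] assms(2,3) by (cases "x \<in> set ys") auto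
  qed simp
  then show ?thesis
    using assms(1) by (simp add: dlookup_def dfold_enc_list)
qed

lemma dlookup_enc_list_None:
  assumes "\<And>y. y \<in> set xs \<Longrightarrow> K y \<noteq> e"
  shows "dlookup K R e (enc_list xs) = DNil"
  using assms unfolding dlookup_def dfold_enc_list by (induction xs) auto

lemma ptime_rev: 
  assumes "ptime f"
  shows "ptime (\<lambda>d. drev (f d))"
  unfolding drev_def
  by (intro ptime_dfold[where G = "\<lambda>d. dsize d"] ptime_Cons ptime_hd ptime_tl ptime_id
      assms ptime_const poly_bounded_intros) simp

lemma ptime_append:
  assumes "ptime f" "ptime g"
  shows "ptime (\<lambda>d. dappend (f d) (g d))"
  unfolding dappend_def
  by (intro ptime_dfold[where G = "\<lambda>d. dsize d"] ptime_Cons ptime_hd ptime_tl ptime_id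
      ptime_rev assms ptime_const poly_bounded_intros) simp

lemma dsize_dfold_DCons: "dsize (dfold (\<lambda>e x a. DCons x a) e l a) + 1 = dsize l + dsize a"
  by (induction l arbitrary: a) auto

lemma dsize_dappend: "dsize (dappend l l') \<le> dsize l + dsize l'"
  using dsize_dfold_DCons[of DNil l DNil] dsize_dfold_DCons[of DNil "drev l" l']
  by (simp add: dappend_def drev_def)

lemma ptime_concat_map:
  assumes G: "ptime (\<lambda>d. G (dhd d) (dtl d))" and "ptime f" "ptime g"
  shows "ptime (\<lambda>d. dconcat_map G (f d) (g d))"
  unfolding dconcat_map_def
proof (rule ptime_dfold[where G = "\<lambda>d. dsize (G (dhd d) (dtl d))"])
  have "ptime (\<lambda>d. DCons (dhd d) (dhd (dtl d)))"
    by (intro ptime_Cons ptime_hd ptime_tl ptime_id)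
  from ptime_compose[OF G this] have "ptime (\<lambda>d. G (dhd d) (dhd (dtl d)))" by simp
  then show "ptime (\<lambda>d. dappend (G (dhd d) (dhd (dtl d))) (dtl (dtl d)))"
    by (intro ptime_append ptime_tl ptime_id)
  show "poly_bounded (\<lambda>d. dsize (G (dhd d) (dtl d)))"
    by (rule ptime_dsize[OF G])
  show "dsize (dappend (G e x) a) \<le> dsize a + dsize (G (dhd (DCons e x)) (dtl (DCons e x)))" for e x a
    using dsize_dappend[of "G e x" a] by simp
qed (intro assms ptime_rev ptime_const)+

lemma ptime_lookup:
  assumes K: "ptime K" and R: "ptime R" and "ptime f" "ptime g"
  shows "ptime (\<lambda>d. dlookup K R (f d) (g d))"
  unfolding dlookup_def
proof (rule ptime_dfold[where G = "\<lambda>d. dsize (R (dtl d))"])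
  show "ptime (\<lambda>d. if K (dhd (dtl d)) = dhd d then R (dhd (dtl d)) else dtl (dtl d))"
    by (intro ptime_If_eq ptime_compose[OF K] ptime_compose[OF R] ptime_hd ptime_tl ptime_id)
  show "poly_bounded (\<lambda>d. dsize (R (dtl d)))"
    by (intro ptime_dsize ptime_compose[OF R] ptime_tl ptime_id)
qed (auto intro: assms ptime_const)

lemmas ptime_intros = ptime_id ptime_const ptime_Cons ptime_hd ptime_tl ptime_append

subsection \<open>Numbering of lists of numbers\<close>

fun bits :: "nat \<Rightarrow> bool list" where
  "bits m = (if m = 0 then [] else odd m # bits (m div 2))"

declare bits.simps [simp del]

text \<open>A number is stored as the list of its bits, so list programs can build numbers directly
  and no arithmetic has to be programmed.\<close>

lemma enc_nat_bits: "enc_nat m = enc_list (map of_bool_data (bits m))"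
proof (induction m rule: less_induct)
  case (less m)
  then show ?case
    by (subst enc_nat.simps, subst bits.simps) auto
qed

lemma enc_list_bits_inject:
  "enc_list (map of_bool_data bs) = enc_list (map of_bool_data cs) \<longleftrightarrow> bs = cs"
  using of_bool_data_eq_iff by (auto simp: enc_list_inject inj_on_def intro: map_injective)

text \<open>Every bit \<open>b\<close> of an entry is written as the pair \<open>1b\<close>, and an entry is terminated by \<open>0\<close>; the
  last bit is the leading digit, which must not vanish.\<close>

definition code_bits :: "nat list \<Rightarrow> bool list" where
  "code_bits ns = concat (map (\<lambda>n. concat (map (\<lambda>b. [True, b]) (bits n)) @ [False]) ns)"

definition code :: "nat list \<Rightarrow> nat" where
  "code ns = horner_sum of_bool 2 (code_bits ns @ [True])"

text \<open>The final \<open>True\<close> keeps every intermediate number positive, so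
  \<open>enc_nat\<close> does not stop before the end of the list.\<close>

lemma enc_nat_horner_sum:
  "enc_nat (horner_sum of_bool 2 (bs @ [True])) = enc_list (map of_bool_data (bs @ [True]))"
proof (induction bs)
  case Nil
  show ?case by (simp add: enc_nat.simps[of "Suc 0"] enc_nat.simps[of 0])
next
  case (Cons b bs)
  define m :: nat where "m = horner_sum of_bool 2 (bs @ [True])"
  have "0 < m"
    unfolding m_def by (induction bs) auto
  then have "enc_nat (of_bool b + m * 2) = DCons (of_bool_data b) (enc_nat m)"
    by (subst enc_nat.simps) auto
  then show ?case
    using Cons by (simp add: m_def mult.commute)
qed

lemma enc_nat_code: "enc_nat (code ns) = enc_list (map of_bool_data (code_bits ns @ [True]))"
  unfolding code_def by (rule enc_nat_horner_sum)

text \<open>The code of an entry is self-delimiting: each bit is preceded by the marker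
  \<open>True\<close>, and the first marker \<open>False\<close> ends the entry.\<close>

lemma concat_pairs_cancel:
  "concat (map (\<lambda>b. [True, b]) bs) @ False # us = concat (map (\<lambda>b. [True, b]) cs) @ False # vs \<longleftrightarrow>
   bs = cs \<and> us = vs"
proof (induction bs arbitrary: cs)
  case Nil
  then show ?case by (cases cs) auto
next
  case (Cons b bs)
  then show ?case by (cases cs) auto
qed

lemma code_bits_inject: "code_bits ns @ [True] = code_bits ms @ [True] \<Longrightarrow> ns = ms"
proof (induction ns arbitrary: ms)
  case Nil
  then show ?case by (cases ms) (auto simp: code_bits_def)
next
  case (Cons n ns)
  then obtain m ms' where ms: "ms = m # ms'"
    by (cases ms) (auto simp: code_bits_def)
  have "concat (map (\<lambda>b. [True, b]) (bits n)) @ False # (code_bits ns @ [True]) =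
      concat (map (\<lambda>b. [True, b]) (bits m)) @ False # (code_bits ms' @ [True])"
    using Cons.prems by (simp add: ms code_bits_def)
  then have "bits n = bits m" "code_bits ns @ [True] = code_bits ms' @ [True]"
    unfolding concat_pairs_cancel by auto
  then show ?case
    using Cons.IH enc_nat_inject[of n m] by (simp add: ms enc_nat_bits)
qed

text \<open>Circuit nodes are numbers, while the construction works with lists; injectivity lets
  \<open>inv code\<close> read the list back from the number.\<close>

lemma inj_code: "inj code"
proof (rule injI)
  fix ns ms
  assume "code ns = code ms"
  then have "enc_nat (code ns) = enc_nat (code ms)" by simp
  then show "ns = ms"
    unfolding enc_nat_code enc_list_bits_inject by (rule code_bits_inject)
qed

definition dcode :: "data \<Rightarrow> data" where
  "dcode l = dappend (dconcat_map (\<lambda>_ n. dappend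
      (dconcat_map (\<lambda>_ b. DCons dTrue (DCons b DNil)) DNil n) (DCons dFalse DNil)) DNil l)
    (DCons dTrue DNil)"

lemma dcode_enc: "dcode (enc_list (map enc_nat ns)) = enc_nat (code ns)"
proof -
  have "dconcat_map (\<lambda>_ b. DCons dTrue (DCons b DNil)) DNil (enc_nat n) =
      enc_list (map of_bool_data (concat (map (\<lambda>b. [True, b]) (bits n))))" for n
    unfolding enc_nat_bits
    by (subst dconcat_map_enc_list[where g = "\<lambda>b. map of_bool_data [True, b]"])
      (auto simp: map_concat comp_def)
  then have "dappend (dconcat_map (\<lambda>_ b. DCons dTrue (DCons b DNil)) DNil (enc_nat n)) (DCons dFalse DNil) =
      enc_list (map of_bool_data (concat (map (\<lambda>b. [True, b]) (bits n)) @ [False]))" for n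
    using dappend_enc_list[of _ "[dFalse]"] by simp
  then have "dconcat_map (\<lambda>_ n. dappend
      (dconcat_map (\<lambda>_ b. DCons dTrue (DCons b DNil)) DNil n) (DCons dFalse DNil)) DNil
      (enc_list (map enc_nat ns)) = enc_list (map of_bool_data (code_bits ns))"
    by (subst dconcat_map_enc_list[where
          g = "\<lambda>n. map of_bool_data (concat (map (\<lambda>b. [True, b]) (bits n)) @ [False])"])
      (auto simp: code_bits_def map_concat comp_def)
  then show ?thesis
    using dappend_enc_list[of _ "[dTrue]"] by (simp add: dcode_def enc_nat_code)
qed

lemma ptime_code: "ptime f \<Longrightarrow> ptime (\<lambda>d. dcode (f d))"
  unfolding dcode_def by (intro ptime_intros ptime_concat_map)

section \<open>Heights in acyclic relations\<close>

definition height :: "('a \<times> 'a) set \<Rightarrow> 'a \<Rightarrow> nat" where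
  "height r x = Max {m. \<exists>y. (x, y) \<in> r ^^ m}"

text \<open>A chain from \<open>x\<close> is empty or continues from one of finitely many
  successors, so induction along the converse relation applies. Finiteness is what makes the
  \<open>Max\<close> in \<open>height\<close> meaningful.\<close>

lemma finite_relpow_lengths:
  assumes "finite r" "acyclic r"
  shows "finite {m. \<exists>y. (x, y) \<in> r ^^ m}"
  using finite_acyclic_wf_converse[OF assms]
proof (induction x rule: wf_induct_rule)
  case (less x)
  have "{m. \<exists>y. (x, y) \<in> r ^^ m} \<subseteq> {0} \<union> Suc ` (\<Union>z\<in>r `` {x}. {m. \<exists>y. (z, y) \<in> r ^^ m})"
  proof
    fix m assume "m \<in> {m. \<exists>y. (x, y) \<in> r ^^ m}"
    then obtain y where "(x, y) \<in> r ^^ m" by blast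
    then show "m \<in> {0} \<union> Suc ` (\<Union>z\<in>r `` {x}. {m. \<exists>y. (z, y) \<in> r ^^ m})"
    proof (cases m)
      case (Suc m')
      with \<open>(x, y) \<in> r ^^ m\<close> obtain z where "(x, z) \<in> r" "(z, y) \<in> r ^^ m'"
        by (blast dest: relpow_Suc_D2)
      then show ?thesis using Suc by auto
    qed simp
  qed
  moreover have "finite (r `` {x})"
    using assms(1) by simp
  moreover have "finite {m. \<exists>y. (z, y) \<in> r ^^ m}" if "z \<in> r `` {x}" for z
    using less that by simp
  ultimately show ?case
    by (rule_tac finite_subset) auto
qed

lemma relpow_le_height:
  assumes "finite r" "acyclic r" "(x, y) \<in> r ^^ m"
  shows "m \<le> height r x"
  unfolding height_def using assms by (intro Max_ge finite_relpow_lengths) auto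

lemma height_relpow:
  assumes "finite r" "acyclic r"
  obtains y where "(x, y) \<in> r ^^ height r x"
proof -
  have "height r x \<in> {m. \<exists>y. (x, y) \<in> r ^^ m}"
    unfolding height_def
    by (rule Max_in[OF finite_relpow_lengths[OF assms]]) (auto intro: exI[of _ 0])
  then show ?thesis using that by blast
qed

lemma height_less:
  assumes "finite r" "acyclic r" "(x, z) \<in> r"
  shows "height r z < height r x"
proof -
  obtain y where "(z, y) \<in> r ^^ height r z"
    using height_relpow[OF assms(1,2)] by blast
  with assms(3) have "(x, y) \<in> r ^^ Suc (height r z)"
    by (rule relpow_Suc_I2)
  from relpow_le_height[OF assms(1,2) this] show ?thesis
    by simp
qed

lemma height_eq_0:
  assumes "finite r" "acyclic r" "x \<notin> Domain r"
  shows "height r x = 0"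
proof -
  obtain y where "(x, y) \<in> r ^^ height r x"
    using height_relpow[OF assms(1,2)] by blast
  then show ?thesis
    using assms(3) by (cases "height r x") (auto dest: relpow_Suc_D2 simp del: relpow.simps)
qed

section \<open>The circuit of a light form\<close>

text \<open>These are the \<open>k ^ k\<close> maps \<alpha> from parties to classes. Positions
  count from 0, so entry \<open>i\<close> belongs to party \<open>Suc i\<close>.\<close>

definition roles :: "nat \<Rightarrow> nat list list" where
  "roles k = List.n_lists k [0..<k]"

text \<open>\<open>role_index\<close> is unspecified on lists that are not in \<open>roles k\<close>.\<close>

definition role_index :: "nat \<Rightarrow> nat list \<Rightarrow> nat" where
  "role_index k \<alpha> = (SOME a. a < length (roles k) \<and> roles k ! a = \<alpha>)"

text \<open>The subclass \<open>(j, B)\<close> consists of the inputs in class \<open>j\<close> which send the message \<open>a \<in> B\<close> at the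
  \<open>a\<close>-th node of the tuple. Subclasses are named by their positions in \<open>classes k\<close>, and each node of
  the circuit is a tuple together with the list of the subclasses not yet forgotten.\<close>

definition classes :: "nat \<Rightarrow> (nat \<times> nat set) list" where
  "classes k = (SOME cs. set cs = {..<k} \<times> Pow {..<length (roles k)})"

text \<open>All lists of admissible length are taken, whether or not they are reached, which makes
  the node set a product that is easy to enumerate. Length \<open>k\<close> is excluded because the
  tuple advances as soon as \<open>k\<close> subclasses remain.\<close>

definition remainders :: "nat \<Rightarrow> nat list list" where
  "remainders k = (SOME Rs. set Rs =
     {R. set R \<subseteq> {..<length (classes k)} \<and> k < length R \<and> length R \<le> length (classes k)} \<and>
     distinct Rs)"

definition drop_at :: "nat \<Rightarrow> 'a list \<Rightarrow> 'a list" where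
  "drop_at p R = take p R @ drop (Suc p) R"

definition child :: "'z light_form_scheme \<Rightarrow> bool \<Rightarrow> nat \<Rightarrow> nat" where
  "child L b v = head (dag L) (THE e. e \<in> out_arcs (dag L) v \<and> arc_label L e = b)"

text \<open>Every party announces a bit, and the owner of the node decides. A terminal node has no
  owner, so a finished run stays where it is.\<close>

fun advance :: "'z light_form_scheme \<Rightarrow> (nat \<times> bool) list \<Rightarrow> nat \<Rightarrow> nat" where
  "advance L [] v = v"
| "advance L ((i, b) # ms) v = (if v \<in> part L i then child L b v else advance L ms v)"

text \<open>Once the subclasses \<open>R\<close> remain, party \<open>i\<close> of the run with roles \<open>roles k ! a\<close> plays subclass
  \<open>R ! (roles k ! a ! i)\<close>; until now this was the run number \<open>prev_role k R a\<close>.\<close>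

definition prev_role :: "nat \<Rightarrow> nat list \<Rightarrow> nat \<Rightarrow> nat" where
  "prev_role k R a = role_index k (map (\<lambda>j. fst (classes k ! (R ! j))) (roles k ! a))"

definition messages :: "nat \<Rightarrow> nat list \<Rightarrow> nat \<Rightarrow> (nat \<times> bool) list" where
  "messages k R a = map (\<lambda>i. (Suc i, prev_role k R a \<in> snd (classes k ! (R ! (roles k ! a ! i))))) [0..<k]"

definition next_tuple :: "nat \<Rightarrow> 'z light_form_scheme \<Rightarrow> nat list \<Rightarrow> nat list \<Rightarrow> nat list" where
  "next_tuple k L R \<tau> =
     map (\<lambda>a. advance L (messages k R a) (\<tau> ! prev_role k R a)) [0..<length (roles k)]"

text \<open>When \<open>k\<close> subclasses remain, they become the new classes: all runs move, and
  splitting starts afresh with the full list of subclasses.\<close>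

definition target :: "nat \<Rightarrow> 'z light_form_scheme \<Rightarrow> nat list \<Rightarrow> nat list \<Rightarrow> nat" where
  "target k L R \<tau> =
     code (if length R = k then next_tuple k L R \<tau> @ [0..<length (classes k)] else \<tau> @ R)"

text \<open>This is the position of the identity map, the run in which every class is played by some
  party.\<close>

definition diagonal :: "nat \<Rightarrow> nat" where
  "diagonal k = role_index k [0..<k]"

text \<open>The wires forget positions \<open>0\<close> to \<open>k\<close> of \<open>R\<close>,
  even if \<open>R\<close> is longer. Every list in \<open>remainders k\<close> has these
  positions.\<close>

definition node_gate :: "nat \<Rightarrow> 'z light_form_scheme \<Rightarrow> nat list \<Rightarrow> nat list \<Rightarrow> gate" where
  "node_gate k L R \<tau> =
     (if \<tau> ! diagonal k \<in> terminals L then Input (out_label L (\<tau> ! diagonal k))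
      else Thr (map (\<lambda>p. target k L (drop_at p R) \<tau>) [0..<Suc k]))"

definition tuples :: "nat \<Rightarrow> 'z light_form_scheme \<Rightarrow> nat list set" where
  "tuples k L = {\<tau>. set \<tau> \<subseteq> verts (dag L) \<and> length \<tau> = length (roles k)}"

definition protocol_circuit :: "nat \<Rightarrow> 'z light_form_scheme \<Rightarrow> circuit" where
  "protocol_circuit k L =
     \<lparr>nodes = (\<lambda>(\<tau>, R). code (\<tau> @ R)) ` (tuples k L \<times> set (remainders k)),
      out = code (replicate (length (roles k)) (start L) @ [0..<length (classes k)]),
      gate = (\<lambda>v. let ns = inv code v
        in node_gate k L (drop (length (roles k)) ns) (take (length (roles k)) ns))\<rparr>"

section \<open>Combinatorics of roles, classes and remainders\<close>

lemma set_roles: "set (roles k) = {\<alpha>. length \<alpha> = k \<and> set \<alpha> \<subseteq> {..<k}}"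
  by (auto simp: roles_def set_n_lists)

lemma role_nth:
  assumes "a < length (roles k)"
  shows "length (roles k ! a) = k" "i < k \<Longrightarrow> roles k ! a ! i < k"
proof -
  have "roles k ! a \<in> set (roles k)" using assms by simp
  then have *: "length (roles k ! a) = k" "set (roles k ! a) \<subseteq> {..<k}" unfolding set_roles by auto
  then show "length (roles k ! a) = k" by simp
  show "roles k ! a ! i < k" if "i < k"
    using *(1) that nth_mem[of i "roles k ! a"] subsetD[OF *(2), of "roles k ! a ! i"] by simp
qed

lemma role_index:
  assumes "length \<alpha> = k" "set \<alpha> \<subseteq> {..<k}"
  shows "role_index k \<alpha> < length (roles k)" "roles k ! role_index k \<alpha> = \<alpha>"
proof -
  have "\<alpha> \<in> set (roles k)" using assms by (simp add: set_roles)
  then have "\<exists>a. a < length (roles k) \<and> roles k ! a = \<alpha>" by (simp add: in_set_conv_nth)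
  from someI_ex[OF this] show "role_index k \<alpha> < length (roles k)" "roles k ! role_index k \<alpha> = \<alpha>"
    by (auto simp: role_index_def)
qed

lemma diagonal: "diagonal k < length (roles k)" "i < k \<Longrightarrow> roles k ! diagonal k ! i = i"
  using role_index[of "[0..<k]" k] by (simp_all add: diagonal_def atLeast0LessThan)

lemma set_classes: "set (classes k) = {..<k} \<times> Pow {..<length (roles k)}"
proof -
  have "\<exists>cs. set cs = {..<k} \<times> Pow {..<length (roles k)}"
    by (intro finite_list) simp
  then show ?thesis
    unfolding classes_def by (rule someI_ex)
qed

lemma class_nth: "c < length (classes k) \<Longrightarrow> fst (classes k ! c) < k"
  using nth_mem[of c "classes k"] set_classes[of k] by (simp add: mem_Times_iff)

lemma remainders:
  "distinct (remainders k)" "set (remainders k) =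
     {R. set R \<subseteq> {..<length (classes k)} \<and> k < length R \<and> length R \<le> length (classes k)}"
proof -
  have "finite {R. set R \<subseteq> {..<length (classes k)} \<and> k < length R \<and> length R \<le> length (classes k)}"
    by (rule finite_subset[OF _ finite_lists_length_le[of "{..<length (classes k)}" "length (classes k)"]]) blast+
  from someI_ex[OF finite_distinct_list[OF this], folded remainders_def]
  show "distinct (remainders k)" "set (remainders k) =
     {R. set R \<subseteq> {..<length (classes k)} \<and> k < length R \<and> length R \<le> length (classes k)}"
    by simp_all
qed

text \<open>Splitting must leave at least \<open>k + 1\<close> subclasses, or else the full list
  would not supply the inputs of a gate. There are \<open>k * 2 ^ E\<close> of them with
  \<open>E > 0\<close>.\<close>

lemma length_classes:
  assumes "0 < k"
  shows "k < length (classes k)"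
proof -
  define E where "E = length (roles k)"
  have "0 < E"
    using diagonal(1)[of k] unfolding E_def by linarith
  then have "(1::nat) < 2 ^ E"
    by (intro one_less_power) auto
  with assms have "k * 1 < k * 2 ^ E"
    by (intro mult_strict_left_mono) auto
  also have "k * 2 ^ E = card (set (classes k))"
    unfolding set_classes by (simp add: card_cartesian_product card_Pow E_def)
  also have "\<dots> \<le> length (classes k)"
    by (rule card_length)
  finally show ?thesis by simp
qed

lemma length_drop_at: "p < length R \<Longrightarrow> length (drop_at p R) = length R - 1"
  by (simp add: drop_at_def)

lemma set_drop_at: "set (drop_at p R) \<subseteq> set R"
  unfolding drop_at_def using set_take_subset[of p R] set_drop_subset[of "Suc p" R] by auto

lemma in_set_drop_at:
  assumes "q < length R" "p \<noteq> q"
  shows "R ! q \<in> set (drop_at p R)"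
proof (cases "q < p")
  case True
  then have "take p R ! q \<in> set (take p R)"
    using assms by (intro nth_mem) simp
  then show ?thesis using True by (simp add: drop_at_def)
next
  case False
  then have "drop (Suc p) R ! (q - Suc p) \<in> set (drop (Suc p) R)"
    using assms by (intro nth_mem) auto
  then show ?thesis using False assms by (simp add: drop_at_def)
qed

text \<open>In the old run each party plays the class containing its new subclass. Hence the
  messages recorded in that subclass concern the node which this run has reached.\<close>

lemma prev_role:
  assumes "length R = k" "set R \<subseteq> {..<length (classes k)}" "a < length (roles k)"
  shows "prev_role k R a < length (roles k)"
    and "i < k \<Longrightarrow> roles k ! prev_role k R a ! i = fst (classes k ! (R ! (roles k ! a ! i)))"
proof -
  define \<alpha> where "\<alpha> = map (\<lambda>j. fst (classes k ! (R ! j))) (roles k ! a)"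
  have "set (roles k ! a) \<subseteq> {..<k}"
    using nth_mem[OF assms(3)] unfolding set_roles by blast
  then have "set \<alpha> \<subseteq> {..<k}"
  proof -
    have "fst (classes k ! (R ! j)) < k" if "j < k" for j
      using that assms(1) nth_mem[of j R] subsetD[OF assms(2), of "R ! j"] by (intro class_nth) auto
    with \<open>set (roles k ! a) \<subseteq> {..<k}\<close> show ?thesis
      unfolding \<alpha>_def by auto
  qed
  moreover have "length \<alpha> = k"
    using role_nth[OF assms(3)] by (simp add: \<alpha>_def)
  ultimately show "prev_role k R a < length (roles k)"
    "i < k \<Longrightarrow> roles k ! prev_role k R a ! i = fst (classes k ! (R ! (roles k ! a ! i)))"
    using role_index[of \<alpha> k] role_nth(1)[OF assms(3)] unfolding prev_role_def \<alpha>_def by auto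
qed

lemma advance_stay: "(\<And>i b. (i, b) \<in> set ms \<Longrightarrow> v \<notin> part L i) \<Longrightarrow> advance L ms v = v"
proof (induction L ms v rule: advance.induct)
  case (2 L i b ms v)
  have "v \<notin> part L i" "\<And>i b. (i, b) \<in> set ms \<Longrightarrow> v \<notin> part L i"
    using 2(2) by (meson list.set_intros)+
  with 2(1) show ?case by simp
qed simp

lemma advance_child:
  assumes "(i, b) \<in> set ms" "v \<in> part L i"
    and "\<And>i' b'. (i', b') \<in> set ms \<Longrightarrow> v \<in> part L i' \<Longrightarrow> b' = b"
  shows "advance L ms v = child L b v"
  using assms
proof (induction L ms v rule: advance.induct)
  case (2 L i' b' ms v)
  show ?case
  proof (cases "v \<in> part L i'")
    case True
    have "b' = b" by (rule 2(4)[OF _ True]) simp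
    then show ?thesis using True by simp
  next
    case False
    have "(i, b) \<in> set ms" using 2(2,3) False by auto
    moreover have "b'' = b" if "(i'', b'') \<in> set ms" "v \<in> part L i''" for i'' b''
      using that by (intro 2(4)[of i'' b'']) auto
    ultimately have "advance L ms v = child L b v"
      using 2(1)[OF False _ 2(3)] by blast
    then show ?thesis using False by simp
  qed
qed simp

lemma out_protocol_circuit:
  "out (protocol_circuit k L) =
     code (replicate (length (roles k)) (start L) @ [0..<length (classes k)])"
  by (simp add: protocol_circuit_def)

lemma nodes_protocol_circuit:
  "nodes (protocol_circuit k L) = (\<lambda>(\<tau>, R). code (\<tau> @ R)) ` (tuples k L \<times> set (remainders k))"
  by (simp add: protocol_circuit_def)

lemma gate_protocol_circuit:
  "length \<tau> = length (roles k) \<Longrightarrow> gate (protocol_circuit k L) (code (\<tau> @ R)) = node_gate k L R \<tau>"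
  by (simp add: protocol_circuit_def inv_f_f[OF inj_code])

lemma card_nodes_protocol_circuit:
  assumes "finite (verts (dag L))"
  shows "card (nodes (protocol_circuit k L)) \<le>
    length (remainders k) * card (verts (dag L)) ^ length (roles k)"
proof -
  have fin: "finite (tuples k L)"
    unfolding tuples_def using assms by (rule finite_lists_length_eq)
  have "card (nodes (protocol_circuit k L)) \<le> card (tuples k L \<times> set (remainders k))"
    unfolding nodes_protocol_circuit using fin by (intro card_image_le) auto
  also have "\<dots> = card (verts (dag L)) ^ length (roles k) * card (set (remainders k))"
    unfolding card_cartesian_product tuples_def using assms by (simp add: card_lists_length_eq)
  also have "\<dots> \<le> length (remainders k) * card (verts (dag L)) ^ length (roles k)"
    using card_length[of "remainders k"] by (simp add: mult.commute)
  finally show ?thesis .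
qed

section \<open>Correctness of the circuit\<close>

locale strong_protocol =
  fixes k n :: nat and f :: "bool list \<Rightarrow> bool" and \<pi> :: "bool list protocol"
  assumes k_pos: "0 < k"
    and protocol: "is_protocol k {..<n} \<pi>"
    and strong: "strongly_computes k n f \<pi>"
begin

section \<open>Moves of the protocol and compatibility of inputs\<close>

abbreviation "step \<equiv> arcs_ends (dag \<pi>)"
abbreviation "V \<equiv> verts (dag \<pi>)"

sublocale fin_digraph "dag \<pi>"
  using protocol by (simp add: is_protocol_def)

lemma step_acyclic: "finite step" "acyclic step"
  using protocol finite_arcs by (auto simp: is_protocol_def arcs_ends_def)

lemma start_in_V: "start \<pi> \<in> V"
  using protocol by (simp add: is_protocol_def)

lemma nonterminal_part:
  assumes "v \<in> V" "v \<notin> terminals \<pi>"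
  obtains i where "i < k" "v \<in> part \<pi> (Suc i)"
proof -
  have "v \<in> (\<Union>i\<in>{1..k}. part \<pi> i)"
    using assms protocol by (simp add: is_protocol_def)
  then obtain i where "i \<in> {1..k}" "v \<in> part \<pi> i" by blast
  then show ?thesis using that[of "i - 1"] by auto
qed

lemma part_nonterminal: "i < k \<Longrightarrow> v \<in> part \<pi> (Suc i) \<Longrightarrow> v \<in> V - terminals \<pi>"
  using protocol unfolding is_protocol_def by fastforce

lemma part_unique:
  assumes "i < k" "j < k" "v \<in> part \<pi> (Suc i)" "v \<in> part \<pi> (Suc j)"
  shows "i = j"
proof (rule ccontr)
  assume "i \<noteq> j"
  moreover have "disjoint_family_on (part \<pi>) {1..k}"
    using protocol by (simp add: is_protocol_def)
  ultimately have "part \<pi> (Suc i) \<inter> part \<pi> (Suc j) = {}"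
    using assms(1,2) unfolding disjoint_family_on_def by auto
  then show False using assms by blast
qed

lemma out_label_less: "t \<in> terminals \<pi> \<Longrightarrow> out_label \<pi> t < n"
  using protocol by (auto simp: is_protocol_def)

lemma child_arc:
  assumes "v \<in> V" "v \<notin> terminals \<pi>"
  obtains e where "e \<in> arcs (dag \<pi>)" "tail (dag \<pi>) e = v" "head (dag \<pi>) e = child \<pi> b v" "arc_label \<pi> e = b"
    and "\<And>e'. e' \<in> arcs (dag \<pi>) \<Longrightarrow> tail (dag \<pi>) e' = v \<Longrightarrow> arc_label \<pi> e' = b \<Longrightarrow> e' = e"
proof -
  have bij: "bij_betw (arc_label \<pi>) (out_arcs (dag \<pi>) v) UNIV"
    using assms protocol by (simp add: is_protocol_def)
  have "b \<in> arc_label \<pi> ` out_arcs (dag \<pi>) v"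
    using bij_betw_imp_surj_on[OF bij] by simp
  then obtain e where e: "e \<in> out_arcs (dag \<pi>) v" "arc_label \<pi> e = b"
    by blast
  have unique: "e' = e" if "e' \<in> out_arcs (dag \<pi>) v" "arc_label \<pi> e' = b" for e'
    using bij_betw_imp_inj_on[OF bij] e that by (auto dest: inj_onD)
  have "(THE e. e \<in> out_arcs (dag \<pi>) v \<and> arc_label \<pi> e = b) = e"
    by (rule the_equality) (use e unique in blast)+
  then have "child \<pi> b v = head (dag \<pi>) e"
    by (simp add: child_def)
  then show ?thesis
  proof (intro that[of e])
    show "e' = e" if "e' \<in> arcs (dag \<pi>)" "tail (dag \<pi>) e' = v" "arc_label \<pi> e' = b" for e'
      using that by (intro unique) auto
  qed (use e in auto)
qed

lemma child_step: "v \<in> V \<Longrightarrow> v \<notin> terminals \<pi> \<Longrightarrow> (v, child \<pi> b v) \<in> step"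
  by (metis child_arc in_arcs_imp_in_arcs_ends)

lemma child_in_V: "v \<in> V \<Longrightarrow> v \<notin> terminals \<pi> \<Longrightarrow> child \<pi> b v \<in> V"
  by (metis child_arc head_in_verts)

lemma terminal_Domain: "t \<in> terminals \<pi> \<Longrightarrow> t \<notin> Domain step"
  by (auto simp: terminals_def out_arcs_def arcs_ends_def arc_to_ends_def)

lemma compatible_start: "compatible \<pi> i x (start \<pi>)"
  unfolding compatible_def using start_in_V
  by (intro exI[of _ "[]"]) (simp add: awalk_Nil_iff)

text \<open>Append the arc with label \<open>b\<close> to a compatible walk. An arc leaving a node
  of another party imposes no condition on \<open>x\<close>.\<close>

lemma compatible_child:
  assumes "compatible \<pi> i x v" "v \<in> V" "v \<notin> terminals \<pi>" "v \<in> part \<pi> i \<Longrightarrow> msg \<pi> i v x = b"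
  shows "compatible \<pi> i x (child \<pi> b v)"
proof -
  obtain p where p: "awalk (start \<pi>) p v" "\<forall>e\<in>set p. compatible_arc \<pi> i x e"
    using assms(1) by (auto simp: compatible_def)
  obtain e where e: "e \<in> arcs (dag \<pi>)" "tail (dag \<pi>) e = v" "head (dag \<pi>) e = child \<pi> b v" "arc_label \<pi> e = b"
    using child_arc[OF assms(2,3)] by blast
  have "awalk v [e] (child \<pi> b v)"
    using e arc_implies_awalk[of e] by simp
  then have "awalk (start \<pi>) (p @ [e]) (child \<pi> b v)"
    using p(1) by (rule_tac awalk_appendI)
  moreover have "compatible_arc \<pi> i x e"
    using e assms(4) by (auto simp: compatible_arc_def)
  ultimately show ?thesis
    unfolding compatible_def using p(2) by (intro exI[of _ "p @ [e]"]) auto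
qed

lemma advance_terminal:
  assumes "v \<in> terminals \<pi>"
  shows "advance \<pi> (messages k R a) v = v"
  using assms part_nonterminal by (intro advance_stay) (auto simp: messages_def)

lemma advance_nonterminal:
  assumes "i < k" "v \<in> part \<pi> (Suc i)"
  shows "advance \<pi> (messages k R a) v =
    child \<pi> (prev_role k R a \<in> snd (classes k ! (R ! (roles k ! a ! i)))) v"
proof (rule advance_child[OF _ assms(2)])
  fix i' b' assume "(i', b') \<in> set (messages k R a)" "v \<in> part \<pi> i'"
  then obtain j where "j < k" "i' = Suc j" "v \<in> part \<pi> (Suc j)"
      "b' = (prev_role k R a \<in> snd (classes k ! (R ! (roles k ! a ! j))))"
    by (auto simp: messages_def)
  then show "b' = (prev_role k R a \<in> snd (classes k ! (R ! (roles k ! a ! i))))"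
    using part_unique[OF assms(1) _ assms(2)] by blast
qed (use assms(1) in \<open>auto simp: messages_def\<close>)

lemma advance_in_V: "v \<in> V \<Longrightarrow> advance \<pi> (messages k R a) v \<in> V"
  by (metis advance_nonterminal advance_terminal child_in_V nonterminal_part)

text \<open>Runs end at different times. A finished run stays at height 0 and every other run loses
  a level, so the maximal height over a tuple drops whenever it is positive.\<close>

lemma advance_height:
  assumes "v \<in> V" "height step v \<le> Suc h"
  shows "height step (advance \<pi> (messages k R a) v) \<le> h"
proof (cases "v \<in> terminals \<pi>")
  case True
  then show ?thesis
    using height_eq_0[OF step_acyclic terminal_Domain] advance_terminal by simp
next
  case False
  then obtain i where "i < k" "v \<in> part \<pi> (Suc i)"
    using assms(1) nonterminal_part by blast
  then have "(v, advance \<pi> (messages k R a) v) \<in> step"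
    using child_step assms(1) False by (simp add: advance_nonterminal)
  then show ?thesis
    using height_less[OF step_acyclic] assms(2) by fastforce
qed

lemma next_tuple_in_tuples:
  assumes "\<tau> \<in> tuples k \<pi>" "length R = k" "set R \<subseteq> {..<length (classes k)}"
  shows "next_tuple k \<pi> R \<tau> \<in> tuples k \<pi>"
proof -
  have "\<tau> ! prev_role k R a \<in> V" if "a < length (roles k)" for a
    using prev_role(1)[OF assms(2,3) that] assms(1) nth_mem[of "prev_role k R a" \<tau>]
    by (auto simp: tuples_def)
  then show ?thesis
    by (auto simp: tuples_def next_tuple_def intro!: advance_in_V)
qed

section \<open>Well-formedness of the circuit by a decreasing potential\<close>

abbreviation "C \<equiv> protocol_circuit k \<pi>"

lemma gate_C:
  "\<tau> \<in> tuples k \<pi> \<Longrightarrow> gate C (code (\<tau> @ R)) = node_gate k \<pi> R \<tau>"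
  by (simp add: gate_protocol_circuit tuples_def)

lemma full_remainder: "[0..<length (classes k)] \<in> set (remainders k)"
  using length_classes[OF k_pos] by (auto simp: remainders)

lemma drop_at_remainder:
  assumes "R \<in> set (remainders k)" "p < Suc k" "length (drop_at p R) \<noteq> k"
  shows "drop_at p R \<in> set (remainders k)"
  using assms length_drop_at[of p R] set_drop_at[of p R] by (auto simp: remainders)

lemma target_in_nodes:
  assumes "\<tau> \<in> tuples k \<pi>" "R \<in> set (remainders k)" "p < Suc k"
  shows "target k \<pi> (drop_at p R) \<tau> \<in> nodes C"
proof (cases "length (drop_at p R) = k")
  case True
  have "set (drop_at p R) \<subseteq> {..<length (classes k)}"
    using assms(2) set_drop_at[of p R] by (auto simp: remainders)
  then show ?thesis
    unfolding target_def nodes_protocol_circuit using True full_remainder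
      next_tuple_in_tuples[OF assms(1) True] by auto
next
  case False
  then show ?thesis
    unfolding target_def nodes_protocol_circuit using assms(1) drop_at_remainder[OF assms(2,3)] by auto
qed

definition tuple_height :: "nat list \<Rightarrow> nat" where
  "tuple_height \<tau> = Max (height step ` set \<tau>)"

text \<open>The order is lexicographic: first the height of the tuple, then the number of remaining
  subclasses. The subtraction makes the value at the output node exactly
  \<open>length (classes k)\<close> times the depth of the protocol, so the depth bound has no
  additive term. It truncates only when the tuple has height 0.\<close>

definition potential :: "nat \<Rightarrow> nat" where
  "potential v = (let ns = inv code v; N = length (roles k) in
     length (classes k) * tuple_height (take N ns) + length (drop N ns) - length (classes k))"

lemma potential_code:
  "\<tau> \<in> tuples k \<pi> \<Longrightarrow> potential (code (\<tau> @ R)) =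
     length (classes k) * tuple_height \<tau> + length R - length (classes k)"
  by (simp add: potential_def tuples_def inv_f_f[OF inj_code])

lemma roles_nonempty: "roles k \<noteq> []"
  using diagonal(1)[of k] by force

lemma height_le_tuple_height: "v \<in> set \<tau> \<Longrightarrow> height step v \<le> tuple_height \<tau>"
  unfolding tuple_height_def by (intro Max_ge) auto

lemma diagonal_in_V: "\<tau> \<in> tuples k \<pi> \<Longrightarrow> \<tau> ! diagonal k \<in> set \<tau>"
  using diagonal(1)[of k] by (simp add: tuples_def)

text \<open>The diagonal node is not terminal, so the height is some \<open>Suc h\<close> and the
  potential is \<open>l * h + length R\<close>. Forgetting a subclass lowers the second summand; a
  move resets the list but leaves at most \<open>l * h\<close>.\<close>

lemma potential_target:
  assumes \<tau>: "\<tau> \<in> tuples k \<pi>" and R: "R \<in> set (remainders k)" and p: "p < Suc k"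
    and nonterm: "\<tau> ! diagonal k \<notin> terminals \<pi>"
  shows "potential (target k \<pi> (drop_at p R) \<tau>) < potential (code (\<tau> @ R))"
proof -
  define l where "l = length (classes k)"
  have lenR: "k < length R" "length R \<le> l"
    using R by (auto simp: remainders l_def)
  have "0 < tuple_height \<tau>"
  proof -
    have "\<tau> ! diagonal k \<in> V"
      using diagonal_in_V[OF \<tau>] \<tau> by (auto simp: tuples_def)
    then have "0 < height step (\<tau> ! diagonal k)"
      using height_less[OF step_acyclic child_step] nonterm by fastforce
    then show ?thesis
      using height_le_tuple_height[OF diagonal_in_V[OF \<tau>]] by linarith
  qed
  then obtain h where h: "tuple_height \<tau> = Suc h"
    by (cases "tuple_height \<tau>") auto
  have pot: "potential (code (\<tau> @ R)) = l * h + length R"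
    by (simp add: potential_code[OF \<tau>] h l_def)
  show ?thesis
  proof (cases "length (drop_at p R) = k")
    case True
    have R': "set (drop_at p R) \<subseteq> {..<length (classes k)}"
      using R set_drop_at[of p R] by (auto simp: remainders)
    let ?\<tau> = "next_tuple k \<pi> (drop_at p R) \<tau>"
    have "height step v \<le> h" if "v \<in> set ?\<tau>" for v
    proof -
      from that obtain a where a: "a < length (roles k)"
        and v: "v = advance \<pi> (messages k (drop_at p R) a) (\<tau> ! prev_role k (drop_at p R) a)"
        by (auto simp: next_tuple_def)
      have "\<tau> ! prev_role k (drop_at p R) a \<in> set \<tau>"
        using prev_role(1)[OF True R' a] \<tau> by (simp add: tuples_def)
      then show ?thesis
        unfolding v using \<tau> height_le_tuple_height[of _ \<tau>] h
        by (intro advance_height) (auto simp: tuples_def)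
    qed
    then have "tuple_height ?\<tau> \<le> h"
      unfolding tuple_height_def using roles_nonempty by (subst Max_le_iff) (auto simp: next_tuple_def)
    then have "l * tuple_height ?\<tau> \<le> l * h"
      by simp
    moreover have "potential (target k \<pi> (drop_at p R) \<tau>) = l * tuple_height ?\<tau>"
      using next_tuple_in_tuples[OF \<tau> True R'] by (simp add: target_def True potential_code l_def)
    ultimately show ?thesis
      using pot lenR by linarith
  next
    case False
    then have "potential (target k \<pi> (drop_at p R) \<tau>) = l * h + length (drop_at p R)"
      by (simp add: target_def potential_code[OF \<tau>] h l_def)
    then show ?thesis
      using pot length_drop_at[of p R] lenR p by simp
  qed
qed

lemma nodesE:
  assumes "v \<in> nodes C"
  obtains \<tau> R where "\<tau> \<in> tuples k \<pi>" "R \<in> set (remainders k)" "v = code (\<tau> @ R)"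
  using assms by (auto simp: nodes_protocol_circuit)

lemma wires_potential:
  assumes "(u, v) \<in> wires C"
  shows "v \<in> nodes C" "potential v < potential u"
proof -
  have u: "u \<in> nodes C" using assms by (auto simp: wires_def)
  then obtain \<tau> R where *: "\<tau> \<in> tuples k \<pi>" "R \<in> set (remainders k)" "u = code (\<tau> @ R)"
    by (rule nodesE)
  then obtain p where "\<tau> ! diagonal k \<notin> terminals \<pi>" "p < Suc k" "v = target k \<pi> (drop_at p R) \<tau>"
    using assms by (auto simp: wires_def gate_C node_gate_def simp del: upt_Suc split: if_splits)
  then show "v \<in> nodes C" "potential v < potential u"
    using * target_in_nodes potential_target by auto
qed

lemma finite_nodes: "finite (nodes C)"
proof -
  have "finite (tuples k \<pi>)"
    unfolding tuples_def using finite_verts by (rule finite_lists_length_eq)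
  then show ?thesis by (simp add: nodes_protocol_circuit)
qed

lemma start_tuple: "replicate (length (roles k)) (start \<pi>) \<in> tuples k \<pi>"
  using start_in_V by (auto simp: tuples_def)

lemma out_in_nodes: "out C \<in> nodes C"
  unfolding out_protocol_circuit nodes_protocol_circuit using full_remainder start_tuple by force

lemma thr_circuit_C: "thr_circuit (k + 1) n C"
proof -
  have "acyclic (wires C)"
  proof (rule wf_acyclic)
    have "(wires C)\<inverse> \<subseteq> measure potential"
      using wires_potential(2) by auto
    then have "acyclic ((wires C)\<inverse>)"
      by (rule wf_acyclic[OF wf_subset[OF wf_measure]])
    then show "wf (wires C)"
    proof (intro finite_acyclic_wf)
      have "wires C \<subseteq> nodes C \<times> nodes C"
        using wires_potential(1) by (auto simp: wires_def)
      then show "finite (wires C)"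
        using finite_nodes by (meson finite_SigmaI finite_subset)
    qed (simp add: acyclic_converse)
  qed
  moreover have "case gate C v of Input i \<Rightarrow> i < n | Thr vs \<Rightarrow> length vs = Suc k \<and> set vs \<subseteq> nodes C"
    if "v \<in> nodes C" for v
    using that
  proof (rule nodesE)
    fix \<tau> R assume "\<tau> \<in> tuples k \<pi>" "R \<in> set (remainders k)" "v = code (\<tau> @ R)"
    then show ?thesis
      using out_label_less target_in_nodes by (auto simp: gate_C node_gate_def simp del: upt_Suc)
  qed
  ultimately show ?thesis
    using finite_nodes out_in_nodes by (simp add: thr_circuit_def)
qed

subsection \<open>Values of the nodes\<close>

text \<open>Membership is a consistency condition on \<open>x\<close> alone: any party playing the
  class can hold \<open>x\<close> in every such run, and the bits it sends as owner are those
  recorded. Subclasses may overlap.\<close>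

definition in_class :: "nat list \<Rightarrow> nat \<Rightarrow> bool list \<Rightarrow> bool" where
  "in_class \<tau> c x \<longleftrightarrow> (\<forall>a<length (roles k). \<forall>i<k. roles k ! a ! i = fst (classes k ! c) \<longrightarrow>
     compatible \<pi> (Suc i) x (\<tau> ! a) \<and>
     (\<tau> ! a \<in> part \<pi> (Suc i) \<longrightarrow> msg \<pi> (Suc i) (\<tau> ! a) x = (a \<in> snd (classes k ! c))))"

text \<open>Let \<open>B\<close> collect the positions whose node has an owner that would send 1 on
  \<open>x\<close>. A node has at most one owner, so this single set is right for all
  parties.\<close>

lemma in_classI:
  assumes "m < k"
    and compat: "\<And>a i. a < length (roles k) \<Longrightarrow> i < k \<Longrightarrow> roles k ! a ! i = m \<Longrightarrow> compatible \<pi> (Suc i) x (\<tau> ! a)"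
  obtains c where "c < length (classes k)" "in_class \<tau> c x"
proof -
  define B where "B = {a. a < length (roles k) \<and> (\<exists>i<k. \<tau> ! a \<in> part \<pi> (Suc i) \<and> msg \<pi> (Suc i) (\<tau> ! a) x)}"
  have "(m, B) \<in> set (classes k)"
    using assms(1) by (auto simp: set_classes B_def)
  then obtain c where c: "c < length (classes k)" "classes k ! c = (m, B)"
    by (auto simp: in_set_conv_nth)
  moreover have "msg \<pi> (Suc i) (\<tau> ! a) x = (a \<in> B)"
    if "a < length (roles k)" "i < k" "\<tau> ! a \<in> part \<pi> (Suc i)" for a i
    using that part_unique[OF that(2) _ that(3)] unfolding B_def by blast
  then have "in_class \<tau> c x"
    unfolding in_class_def using compat by (simp add: c)
  ultimately show ?thesis using that by blast
qed

text \<open>Subclass \<open>R ! m\<close> becomes class \<open>m\<close>. A party playing it moves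
  from a node compatible with \<open>x\<close>: if it owns that node, the bit used is the recorded
  one, which is its message on \<open>x\<close>; otherwise either child is compatible.\<close>

lemma in_class_next:
  assumes \<tau>: "\<tau> \<in> tuples k \<pi>" and R: "length R = k" "set R \<subseteq> {..<length (classes k)}"
    and "m < k" "in_class \<tau> (R ! m) x"
  obtains c where "c < length (classes k)" "in_class (next_tuple k \<pi> R \<tau>) c x"
proof (rule in_classI[OF \<open>m < k\<close>])
  fix a i
  assume a: "a < length (roles k)" and i: "i < k" "roles k ! a ! i = m"
  define a' where "a' = prev_role k R a"
  define v where "v = \<tau> ! a'"
  have a': "a' < length (roles k)" "roles k ! a' ! i = fst (classes k ! (R ! m))"
    using prev_role[OF R a] i by (simp_all add: a'_def)
  then have v: "v \<in> V"
    using \<tau> nth_mem[of a' \<tau>] by (auto simp: tuples_def v_def)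
  have compat: "compatible \<pi> (Suc i) x v"
    and msg: "v \<in> part \<pi> (Suc i) \<Longrightarrow> msg \<pi> (Suc i) v x = (a' \<in> snd (classes k ! (R ! m)))"
    using \<open>in_class \<tau> (R ! m) x\<close> a' i(1) by (auto simp: in_class_def v_def)
  have "compatible \<pi> (Suc i) x (advance \<pi> (messages k R a) v)"
  proof (cases "v \<in> terminals \<pi>")
    case True
    then show ?thesis using compat by (simp add: advance_terminal)
  next
    case False
    then obtain j where j: "j < k" "v \<in> part \<pi> (Suc j)"
      using v nonterminal_part by blast
    then show ?thesis
      unfolding advance_nonterminal[OF j] using compat v False msg i part_unique[of i j v]
      by (intro compatible_child) (auto simp: a'_def)
  qed
  then show "compatible \<pi> (Suc i) x (next_tuple k \<pi> R \<tau> ! a)"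
    using a by (simp add: next_tuple_def v_def a'_def)
qed (use that in blast)

lemma not_thr2:
  assumes "\<And>p. p < length bs \<Longrightarrow> p \<noteq> q \<Longrightarrow> \<not> bs ! p"
  shows "\<not> thr2 bs"
proof -
  have "length (filter id bs) = card {p. p < length bs \<and> bs ! p}"
    by (simp add: length_filter_conv_card)
  also have "\<dots> \<le> card {q}"
    using assms by (intro card_mono) auto
  finally show ?thesis by (simp add: thr2_def)
qed

text \<open>Induction on the potential. At an input node, the party playing the class of
  \<open>c\<close> in the diagonal run is compatible with the terminal, so strong computation gives
  the value 0. At a gate, every wire that keeps \<open>c\<close> leads to a node satisfying the same
  hypotheses, with \<open>c\<close> split again if the tuple moves.\<close>

lemma node_value_False:
  assumes "x \<in> zeros n f" "\<tau> \<in> tuples k \<pi>" "R \<in> set (remainders k)" "c \<in> set R" "in_class \<tau> c x"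
    and "node_value C x (code (\<tau> @ R)) b"
  shows "\<not> b"
  using assms(2-)
proof (induction "potential (code (\<tau> @ R))" arbitrary: \<tau> R c b rule: less_induct)
  case less
  note \<tau> = less.prems(1) and R = less.prems(2)
  show ?case
  proof (cases "\<tau> ! diagonal k \<in> terminals \<pi>")
    case True
    then have "gate C (code (\<tau> @ R)) = Input (out_label \<pi> (\<tau> ! diagonal k))"
      by (simp add: gate_C[OF \<tau>] node_gate_def)
    then have "b = x ! out_label \<pi> (\<tau> ! diagonal k)"
      using less.prems(5) by (auto elim: node_value.cases)
    moreover have "c < length (classes k)"
      using R less.prems(3) by (auto simp: remainders)
    then have "compatible \<pi> (Suc (fst (classes k ! c))) x (\<tau> ! diagonal k)" "fst (classes k ! c) < k"
      using less.prems(4) class_nth diagonal(1)[of k] diagonal(2)[of "fst (classes k ! c)" k]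
      by (simp_all add: in_class_def)
    moreover have "Suc (fst (classes k ! c)) \<in> {1..k}"
      using calculation by simp
    ultimately show ?thesis
      using strong True \<open>x \<in> zeros n f\<close> unfolding strongly_computes_def by blast
  next
    case False
    then have "gate C (code (\<tau> @ R)) = Thr (map (\<lambda>p. target k \<pi> (drop_at p R) \<tau>) [0..<Suc k])"
      by (simp add: gate_C[OF \<tau>] node_gate_def)
    then obtain bs where b: "b = thr2 bs"
      and bs: "list_all2 (node_value C x) (map (\<lambda>p. target k \<pi> (drop_at p R) \<tau>) [0..<Suc k]) bs"
      using less.prems(5) by (auto elim: node_value.cases simp del: upt_Suc)
    have len: "length bs = Suc k"
      using list_all2_lengthD[OF bs] by simp
    have vals: "node_value C x (target k \<pi> (drop_at p R) \<tau>) (bs ! p)" if "p < Suc k" for p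
      using list_all2_nthD[OF bs, of p] that by (simp del: upt_Suc)
    \<comment> \<open>Any occurrence of \<open>c\<close> will do. If \<open>q\<close> exceeds
      \<open>k\<close>, no wire forgets this occurrence and all inputs of the gate are 0.\<close>
    obtain q where q: "q < length R" "R ! q = c"
      using less.prems(3) by (auto simp: in_set_conv_nth)
    have "\<not> bs ! p" if p: "p < Suc k" "p \<noteq> q" for p
    proof -
      let ?R = "drop_at p R"
      have c: "c \<in> set ?R"
        using in_set_drop_at[OF q(1) p(2)] q by simp
      have smaller: "potential (target k \<pi> ?R \<tau>) < potential (code (\<tau> @ R))"
        using potential_target[OF \<tau> R p(1) False] .
      show ?thesis
      proof (cases "length ?R = k")
        case True
        have R': "set ?R \<subseteq> {..<length (classes k)}"
          using R set_drop_at[of p R] by (auto simp: remainders)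
        obtain m where m: "m < k" "?R ! m = c"
          using c True by (auto simp: in_set_conv_nth)
        obtain c' where c': "c' < length (classes k)" "in_class (next_tuple k \<pi> ?R \<tau>) c' x"
          by (rule in_class_next[OF \<tau> True R' m(1), of x]) (use less.prems(4) m in auto)
        then show ?thesis
          using less.hyps[of "next_tuple k \<pi> ?R \<tau>" "[0..<length (classes k)]" c' "bs ! p"]
            smaller next_tuple_in_tuples[OF \<tau> True R'] full_remainder vals[OF p(1)]
          by (simp add: target_def True)
      next
        case False
        then show ?thesis
          using less.hyps[of \<tau> ?R c "bs ! p"] smaller \<tau> drop_at_remainder[OF R p(1)] c less.prems(4)
            vals[OF p(1)] by (simp add: target_def)
      qed
    qed
    then show ?thesis
      unfolding b using len by (intro not_thr2[of _ q]) auto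
  qed
qed

lemma circuit_le_C: "circuit_le n C f"
  unfolding circuit_le_def
proof
  fix x assume x: "x \<in> zeros n f"
  define \<tau> where "\<tau> = replicate (length (roles k)) (start \<pi>)"
  obtain b where b: "node_value C x (out C) b"
    using node_value_exists[OF thr_circuit_C out_in_nodes] by blast
  \<comment> \<open>Every input is compatible with the start node, so \<open>x\<close> lies in every
    initial class; class 0 is taken, which exists since \<open>k\<close> is positive.\<close>
  obtain c where "c < length (classes k)" "in_class \<tau> c x"
    by (rule in_classI[OF k_pos, of x \<tau>]) (use compatible_start in \<open>auto simp: \<tau>_def\<close>)
  then have "\<not> b"
    using node_value_False[OF x start_tuple full_remainder, of c b] b
    by (simp add: \<tau>_def out_protocol_circuit)
  moreover have "circuit_value C x = b"
    unfolding circuit_value_def using b node_value_unique by (intro the_equality) auto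
  ultimately show "\<not> circuit_value C x" by simp
qed

subsection \<open>Depth\<close>

lemma awalk_relpow:
  assumes "awalk u p v"
  shows "(u, v) \<in> step ^^ length p"
  using assms
proof (induction p arbitrary: u)
  case Nil
  then show ?case by (simp add: awalk_Nil_iff)
next
  case (Cons e p)
  then have e: "e \<in> arcs (dag \<pi>)" "tail (dag \<pi>) e = u" "awalk (head (dag \<pi>) e) p v"
    by (auto simp: awalk_Cons_iff)
  then have "(u, head (dag \<pi>) e) \<in> step"
    by (metis in_arcs_imp_in_arcs_ends)
  from relpow_Suc_I2[OF this Cons.IH[OF e(3)]] show ?case by simp
qed

lemma relpow_awalk:
  assumes "(u, v) \<in> step ^^ m" "u \<in> V"
  shows "\<exists>p. awalk u p v \<and> length p = m"
  using assms
proof (induction m arbitrary: u)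
  case 0
  then show ?case by (simp add: awalk_Nil_iff)
next
  case (Suc m)
  then obtain w where w: "(u, w) \<in> step" "(w, v) \<in> step ^^ m"
    by (blast dest: relpow_Suc_D2)
  then obtain e where e: "e \<in> arcs (dag \<pi>)" "tail (dag \<pi>) e = u" "head (dag \<pi>) e = w"
    by (auto simp: arcs_ends_def arc_to_ends_def)
  then obtain p where "awalk w p v" "length p = m"
    using Suc.IH[OF w(2)] head_in_verts by blast
  then show ?case
    using e by (intro exI[of _ "e # p"]) (auto simp: awalk_Cons_iff)
qed

lemma height_start: "height step (start \<pi>) = protocol_depth \<pi>"
proof -
  have "{length p |p v. awalk (start \<pi>) p v} = {m. \<exists>v. (start \<pi>, v) \<in> step ^^ m}"
    using awalk_relpow relpow_awalk[OF _ start_in_V] by (auto; metis)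
  then show ?thesis
    by (simp add: height_def protocol_depth_def)
qed

lemma wires_relpow_potential: "(u, v) \<in> wires C ^^ m \<Longrightarrow> potential v + m \<le> potential u"
proof (induction m arbitrary: v)
  case (Suc m)
  then obtain w where "(u, w) \<in> wires C ^^ m" "(w, v) \<in> wires C" by auto
  then show ?case
    using Suc.IH[of w] wires_potential(2)[of w v] by linarith
qed simp

text \<open>This shows that the set under the \<open>Max\<close> of \<open>circuit_depth\<close> is
  nonempty: every gate has a wire, and the potential cannot fall forever.\<close>

lemma input_reachable:
  assumes "u \<in> nodes C"
  shows "\<exists>m v i. (u, v) \<in> wires C ^^ m \<and> gate C v = Input i"
  using assms
proof (induction "potential u" arbitrary: u rule: less_induct)
  case less
  show ?case
  proof (cases "gate C u")
    case (Input i)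
    then have "(u, u) \<in> wires C ^^ 0 \<and> gate C u = Input i" by simp
    then show ?thesis by blast
  next
    case (Thr vs)
    then have "length vs = k + 1"
      using thr_circuit_C less.prems by (fastforce simp: thr_circuit_def split: gate.splits)
    then obtain w where "w \<in> set vs"
      by (cases vs) auto
    then have w: "(u, w) \<in> wires C"
      using Thr less.prems by (auto simp: wires_def)
    then obtain m v i where "(w, v) \<in> wires C ^^ m" "gate C v = Input i"
      using less.hyps[of w] wires_potential by blast
    then show ?thesis
      using relpow_Suc_I2[OF w] by blast
  qed
qed

lemma circuit_depth_C: "circuit_depth C \<le> length (classes k) * protocol_depth \<pi>"
proof -
  let ?S = "{m. \<exists>v i. (out C, v) \<in> wires C ^^ m \<and> gate C v = Input i}"
  have "tuple_height (replicate (length (roles k)) (start \<pi>)) = protocol_depth \<pi>"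
    using roles_nonempty by (simp add: tuple_height_def height_start)
  then have "potential (out C) = length (classes k) * protocol_depth \<pi>"
    by (simp add: out_protocol_circuit potential_code[OF start_tuple])
  then have le: "\<forall>m\<in>?S. m \<le> length (classes k) * protocol_depth \<pi>"
    using wires_relpow_potential by fastforce
  then have "finite ?S"
    by (meson finite_nat_set_iff_bounded_le)
  moreover have "?S \<noteq> {}"
    using input_reachable[OF out_in_nodes] by blast
  ultimately show ?thesis
    unfolding circuit_depth_def using le by (simp add: Max_le_iff)
qed

lemma circuit_size_C:
  "circuit_size C \<le> length (remainders k) * protocol_size \<pi> ^ length (roles k)"
  unfolding circuit_size_def protocol_size_def
  by (rule card_nodes_protocol_circuit) simp

end

section \<open>The algorithm\<close>

text \<open>The following functions mirror the construction on encoded data. Whatever depends on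
  \<open>k\<close> alone, such as \<open>roles\<close>, \<open>classes\<close> and
  \<open>remainders\<close>, stays outside \<open>data\<close> and is hard-wired into the
  program.\<close>

definition dnth :: "nat \<Rightarrow> data \<Rightarrow> data" where
  "dnth j l = dhd ((dtl ^^ j) l)"

definition dchild :: "bool \<Rightarrow> data \<Rightarrow> data \<Rightarrow> data" where
  "dchild b d v = dlookup (\<lambda>x. DCons (dhd x) (dhd (dtl x))) (\<lambda>x. dhd (dtl (dtl x)))
     (DCons v (of_bool_data b)) (dnth 2 d)"

text \<open>Parties are numbered from 1 and list positions from 0, hence \<open>i - 1\<close>. The
  lookup is a membership test, with \<open>DNil\<close> for a node outside the part.\<close>

fun dadvance :: "(nat \<times> bool) list \<Rightarrow> data \<Rightarrow> data \<Rightarrow> data" where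
  "dadvance [] d v = v"
| "dadvance ((i, b) # ms) d v =
     (if dlookup (\<lambda>x. x) (\<lambda>x. dTrue) v (dnth (i - 1) (dnth 3 d)) = DNil then dadvance ms d v
      else dchild b d v)"

definition dnext_tuple :: "nat \<Rightarrow> nat list \<Rightarrow> data \<Rightarrow> data \<Rightarrow> data" where
  "dnext_tuple k R d \<tau> =
     enc_list (map (\<lambda>a. dadvance (messages k R a) d (dnth (prev_role k R a) \<tau>)) [0..<length (roles k)])"

definition dtarget :: "nat \<Rightarrow> nat list \<Rightarrow> data \<Rightarrow> data \<Rightarrow> data" where
  "dtarget k R d \<tau> = dcode
     (if length R = k
      then dappend (dnext_tuple k R d \<tau>) (enc_list (map enc_nat [0..<length (classes k)]))
      else dappend \<tau> (enc_list (map enc_nat R)))"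

text \<open>The lookup of the label of a terminal node yields an encoded input gate, which is not
  \<open>DNil\<close> even if the label is 0.\<close>

definition dgate :: "nat \<Rightarrow> nat list \<Rightarrow> data \<Rightarrow> data \<Rightarrow> data" where
  "dgate k R d \<tau> =
     (if dlookup dhd (\<lambda>x. DCons dFalse (dhd (dtl x))) (dnth (diagonal k) \<tau>) (dnth 4 d) = DNil
      then DCons dTrue (enc_list (map (\<lambda>p. dtarget k (drop_at p R) d \<tau>) [0..<Suc k]))
      else dlookup dhd (\<lambda>x. DCons dFalse (dhd (dtl x))) (dnth (diagonal k) \<tau>) (dnth 4 d))"

definition dentry :: "nat \<Rightarrow> nat list \<Rightarrow> data \<Rightarrow> data \<Rightarrow> data" where
  "dentry k R d \<tau> =
     DCons (dcode (dappend \<tau> (enc_list (map enc_nat R)))) (DCons (dgate k R d \<tau>) DNil)"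

text \<open>Environments replace free variables in the two nested loops: the outer one passes on the
  node list, the inner one the tuple to be extended.\<close>

fun dn_lists :: "nat \<Rightarrow> data \<Rightarrow> data" where
  "dn_lists 0 V = DCons DNil DNil"
| "dn_lists (Suc m) V =
     dconcat_map (\<lambda>V \<tau>. dconcat_map (\<lambda>\<tau> v. DCons (DCons v \<tau>) DNil) \<tau> V) V (dn_lists m V)"

definition dcircuit :: "nat \<Rightarrow> data \<Rightarrow> data" where
  "dcircuit k d =
     DCons (dcode (dappend (enc_list (map (\<lambda>_. dnth 1 d) [0..<length (roles k)]))
              (enc_list (map enc_nat [0..<length (classes k)]))))
    (DCons (dconcat_map (\<lambda>d \<tau>. enc_list (map (\<lambda>R. dentry k R d \<tau>) (remainders k))) d
              (dn_lists (length (roles k)) (dnth 0 d))) DNil)"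

subsection \<open>Running time\<close>

lemma ptime_nth:
  assumes "ptime f"
  shows "ptime (\<lambda>d. dnth j (f d))"
proof -
  have "ptime (\<lambda>d. (dtl ^^ j) (f d))"
    using assms by (induction j) (auto intro: ptime_tl)
  then show ?thesis
    unfolding dnth_def by (rule ptime_hd)
qed

text \<open>The list \<open>as\<close> is fixed, so the program is unrolled over it without a
  loop.\<close>

lemma ptime_enc_list: "(\<And>a. a \<in> set as \<Longrightarrow> ptime (\<lambda>d. h a d)) \<Longrightarrow> ptime (\<lambda>d. enc_list (map (\<lambda>a. h a d) as))"
  by (induction as) (auto intro: ptime_Cons ptime_const)

lemma ptime_child: "ptime f \<Longrightarrow> ptime g \<Longrightarrow> ptime (\<lambda>d. dchild b (f d) (g d))"
  unfolding dchild_def by (intro ptime_lookup ptime_intros ptime_nth)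

lemma ptime_advance:
  assumes "ptime f" "ptime g"
  shows "ptime (\<lambda>d. dadvance ms (f d) (g d))"
proof (induction ms)
  case Nil
  show ?case using assms by simp
next
  case (Cons m ms)
  obtain i b where "m = (i, b)" by (cases m)
  then show ?case
    using Cons.IH assms
    by (simp only: dadvance.simps) (intro ptime_if ptime_lookup ptime_child ptime_intros ptime_nth)
qed

lemma ptime_next_tuple: "ptime f \<Longrightarrow> ptime g \<Longrightarrow> ptime (\<lambda>d. dnext_tuple k R (f d) (g d))"
  unfolding dnext_tuple_def by (intro ptime_enc_list ptime_advance ptime_nth)

lemma ptime_target: "ptime f \<Longrightarrow> ptime g \<Longrightarrow> ptime (\<lambda>d. dtarget k R (f d) (g d))"
  unfolding dtarget_def
  by (cases "length R = k")
    (auto intro!: ptime_code ptime_append ptime_const ptime_next_tuple simp del: upt_Suc)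

lemma ptime_gate: "ptime f \<Longrightarrow> ptime g \<Longrightarrow> ptime (\<lambda>d. dgate k R (f d) (g d))"
  unfolding dgate_def
  by (intro ptime_if ptime_lookup ptime_enc_list ptime_target ptime_nth ptime_intros ptime_hd_raw)

lemma ptime_entry: "ptime f \<Longrightarrow> ptime g \<Longrightarrow> ptime (\<lambda>d. dentry k R (f d) (g d))"
  unfolding dentry_def by (intro ptime_code ptime_gate ptime_intros)

text \<open>The length \<open>m\<close> is a constant, so a fixed number of polynomial passes is
  composed.\<close>

lemma ptime_n_lists: "ptime f \<Longrightarrow> ptime (\<lambda>d. dn_lists m (f d))"
  by (induction m) (auto intro!: ptime_concat_map ptime_intros)

lemma ptime_circuit: "ptime (dcircuit k)"
  unfolding dcircuit_def
  by (intro ptime_code ptime_concat_map ptime_enc_list ptime_entry ptime_n_lists ptime_nth ptime_intros)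

subsection \<open>Correctness\<close>

lemma dtl_funpow_enc_list: "(dtl ^^ j) (enc_list xs) = enc_list (drop j xs)"
proof (induction j arbitrary: xs)
  case (Suc j)
  have "(dtl ^^ Suc j) (enc_list xs) = (dtl ^^ j) (enc_list (tl xs))"
    unfolding funpow_Suc_right by (cases xs) auto
  then show ?case
    by (simp add: Suc.IH drop_Suc)
qed simp

lemma dnth_enc_list: "j < length xs \<Longrightarrow> dnth j (enc_list xs) = xs ! j"
  by (simp add: dnth_def dtl_funpow_enc_list flip: Cons_nth_drop_Suc)

lemma dn_lists_enc:
  "dn_lists m (enc_list (map enc_nat vs)) =
     enc_list (map (\<lambda>\<tau>. enc_list (map enc_nat \<tau>)) (List.n_lists m vs))"
proof (induction m)
  case (Suc m)
  have "dconcat_map (\<lambda>\<tau> v. DCons (DCons v \<tau>) DNil) (enc_list (map enc_nat \<tau>)) (enc_list (map enc_nat vs)) =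
      enc_list (map (\<lambda>\<tau>. enc_list (map enc_nat \<tau>)) (map (\<lambda>v. v # \<tau>) vs))" for \<tau>
    by (subst dconcat_map_enc_list[where g = "\<lambda>v. [enc_list (map enc_nat (v # \<tau>))]"]) (auto simp: comp_def)
  then show ?case
    unfolding dn_lists.simps Suc
    by (subst dconcat_map_enc_list[where g = "\<lambda>\<tau>. map (\<lambda>\<tau>. enc_list (map enc_nat \<tau>)) (map (\<lambda>v. v # \<tau>) vs)"])
      (auto simp: map_concat comp_def)
qed simp

section \<open>Agreement of the program with the circuit on an encoded light form\<close>

context strong_protocol
begin

context
  fixes d :: data and vs es :: "nat list" and ps :: "nat list list" and ts :: "nat list"
  assumes vs: "lists_set vs V" and es: "lists_set es (arcs (dag \<pi>))"
    and ps: "list_all2 (\<lambda>p i. lists_set p (part \<pi> i)) ps [1..<Suc k]"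
    and ts: "lists_set ts (terminals \<pi>)"
    and d: "d = enc_list
          [enc_list (map enc_nat vs),
           enc_nat (start \<pi>),
           enc_list (map (\<lambda>e. enc_list [enc_nat (tail (dag \<pi>) e), of_bool_data (arc_label \<pi> e),
                                        enc_nat (head (dag \<pi>) e)]) es),
           enc_list (map (\<lambda>p. enc_list (map enc_nat p)) ps),
           enc_list (map (\<lambda>t. enc_list [enc_nat t, enc_nat (out_label \<pi> t)]) ts)]"
begin

lemma dnth_d:
  "dnth 0 d = enc_list (map enc_nat vs)"
  "dnth 1 d = enc_nat (start \<pi>)"
  "dnth 2 d = enc_list (map (\<lambda>e. enc_list [enc_nat (tail (dag \<pi>) e), of_bool_data (arc_label \<pi> e),
                                        enc_nat (head (dag \<pi>) e)]) es)"
  "dnth 3 d = enc_list (map (\<lambda>p. enc_list (map enc_nat p)) ps)"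
  "dnth 4 d = enc_list (map (\<lambda>t. enc_list [enc_nat t, enc_nat (out_label \<pi> t)]) ts)"
  unfolding d by (subst dnth_enc_list; simp)+

lemma dchild_enc:
  assumes "v \<in> V" "v \<notin> terminals \<pi>"
  shows "dchild b d (enc_nat v) = enc_nat (child \<pi> b v)"
proof -
  obtain e where e: "e \<in> arcs (dag \<pi>)" "tail (dag \<pi>) e = v" "head (dag \<pi>) e = child \<pi> b v" "arc_label \<pi> e = b"
    and unique: "\<And>e'. e' \<in> arcs (dag \<pi>) \<Longrightarrow> tail (dag \<pi>) e' = v \<Longrightarrow> arc_label \<pi> e' = b \<Longrightarrow> e' = e"
    using child_arc[OF assms, of b] by blast
  have set_es: "set es = arcs (dag \<pi>)"
    using es by (simp add: lists_set_def)
  let ?enc = "\<lambda>e. enc_list [enc_nat (tail (dag \<pi>) e), of_bool_data (arc_label \<pi> e), enc_nat (head (dag \<pi>) e)]"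
  show ?thesis
    unfolding dchild_def dnth_d
  proof (rule dlookup_enc_list[where x = "?enc e"])
    show "?enc e \<in> set (map ?enc es)"
      using e(1) set_es by simp
    show "DCons (dhd (?enc e)) (dhd (dtl (?enc e))) = DCons (enc_nat v) (of_bool_data b)"
      using e by simp
    fix y
    assume "y \<in> set (map ?enc es)" and y: "DCons (dhd y) (dhd (dtl y)) = DCons (enc_nat v) (of_bool_data b)"
    then obtain e' where e': "e' \<in> arcs (dag \<pi>)" "y = ?enc e'"
      using set_es by auto
    then have "tail (dag \<pi>) e' = v" "arc_label \<pi> e' = b"
      using y by (simp_all add: enc_nat_inject of_bool_data_eq_iff)
    with e'(1) have "e' = e" by (rule unique)
    then show "dhd (dtl (dtl y)) = enc_nat (child \<pi> b v)"
      using e'(2) e(3) by simp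
  qed
qed

lemma dmember_part:
  assumes "i < k"
  shows "dlookup (\<lambda>x. x) (\<lambda>x. dTrue) (enc_nat v) (dnth i (dnth 3 d)) = DNil \<longleftrightarrow> v \<notin> part \<pi> (Suc i)"
proof -
  have len: "length ps = k"
    using list_all2_lengthD[OF ps] by simp
  have "lists_set (ps ! i) (part \<pi> ([1..<Suc k] ! i))"
    using list_all2_nthD[OF ps] assms len by simp
  then have set_p: "set (ps ! i) = part \<pi> (Suc i)"
    using assms by (simp add: lists_set_def nth_upt del: upt_Suc)
  have p: "dnth i (dnth 3 d) = enc_list (map enc_nat (ps ! i))"
    unfolding dnth_d using assms len by (subst dnth_enc_list) auto
  show ?thesis
  proof (cases "v \<in> part \<pi> (Suc i)")
    case True
    then have "dlookup (\<lambda>x. x) (\<lambda>x. dTrue) (enc_nat v) (enc_list (map enc_nat (ps ! i))) = dTrue"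
      by (intro dlookup_enc_list[where x = "enc_nat v"]) (auto simp: set_p)
    then show ?thesis using True by (simp add: p)
  next
    case False
    then have "dlookup (\<lambda>x. x) (\<lambda>x. dTrue) (enc_nat v) (enc_list (map enc_nat (ps ! i))) = DNil"
      by (intro dlookup_enc_list_None) (auto simp: set_p enc_nat_inject)
    then show ?thesis using False by (simp add: p)
  qed
qed

lemma dadvance_enc:
  assumes "\<And>i b. (i, b) \<in> set ms \<Longrightarrow> 0 < i \<and> i \<le> k"
  shows "dadvance ms d (enc_nat v) = enc_nat (advance \<pi> ms v)"
  using assms
proof (induction ms)
  case (Cons m ms)
  obtain i b where m: "m = (i, b)" by (cases m)
  then have "0 < i" "i \<le> k"
    using Cons.prems[of i b] by simp_all
  then obtain j where j: "i = Suc j" "j < k"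
    by (cases i) auto
  have IH: "dadvance ms d (enc_nat v) = enc_nat (advance \<pi> ms v)"
    by (rule Cons.IH) (use Cons.prems in auto)
  show ?case
  proof (cases "v \<in> part \<pi> (Suc j)")
    case True
    then show ?thesis
      using dmember_part[OF j(2), of v] dchild_enc part_nonterminal[OF j(2) True] by (simp add: m j)
  next
    case False
    then show ?thesis
      using dmember_part[OF j(2), of v] IH by (simp add: m j)
  qed
qed simp

lemma dnext_tuple_enc:
  assumes "\<tau> \<in> tuples k \<pi>" "length R = k" "set R \<subseteq> {..<length (classes k)}"
  shows "dnext_tuple k R d (enc_list (map enc_nat \<tau>)) = enc_list (map enc_nat (next_tuple k \<pi> R \<tau>))"
proof -
  have "dadvance (messages k R a) d (dnth (prev_role k R a) (enc_list (map enc_nat \<tau>))) =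
      enc_nat (advance \<pi> (messages k R a) (\<tau> ! prev_role k R a))" if "a < length (roles k)" for a
    using prev_role(1)[OF assms(2,3) that] assms(1)
    by (subst dnth_enc_list) (auto simp: tuples_def messages_def intro!: dadvance_enc)
  then show ?thesis
    by (auto simp: dnext_tuple_def next_tuple_def intro!: arg_cong[where f = enc_list])
qed

lemma dtarget_enc:
  assumes "\<tau> \<in> tuples k \<pi>" "set R \<subseteq> {..<length (classes k)}"
  shows "dtarget k R d (enc_list (map enc_nat \<tau>)) = enc_nat (target k \<pi> R \<tau>)"
  unfolding dtarget_def target_def
  using assms by (simp add: dnext_tuple_enc dappend_enc_list dcode_enc flip: map_append)

lemma dgate_enc:
  assumes "\<tau> \<in> tuples k \<pi>" "R \<in> set (remainders k)"
  shows "dgate k R d (enc_list (map enc_nat \<tau>)) = enc_gate (node_gate k \<pi> R \<tau>)"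
proof -
  define t where "t = \<tau> ! diagonal k"
  have set_ts: "set ts = terminals \<pi>"
    using ts by (simp add: lists_set_def)
  have t: "dnth (diagonal k) (enc_list (map enc_nat \<tau>)) = enc_nat t"
    using assms(1) diagonal(1)[of k] by (subst dnth_enc_list) (auto simp: tuples_def t_def)
  show ?thesis
  proof (cases "t \<in> terminals \<pi>")
    case True
    have "dlookup dhd (\<lambda>x. DCons dFalse (dhd (dtl x))) (enc_nat t) (dnth 4 d) =
        DCons dFalse (enc_nat (out_label \<pi> t))"
      unfolding dnth_d
      by (rule dlookup_enc_list[where x = "enc_list [enc_nat t, enc_nat (out_label \<pi> t)]"])
        (use True in \<open>auto simp: set_ts enc_nat_inject\<close>)
    then show ?thesis
      using True by (simp add: dgate_def node_gate_def t t_def[symmetric])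
  next
    case False
    have "dlookup dhd (\<lambda>x. DCons dFalse (dhd (dtl x))) (enc_nat t) (dnth 4 d) = DNil"
      unfolding dnth_d
      by (rule dlookup_enc_list_None) (use False in \<open>auto simp: set_ts enc_nat_inject\<close>)
    moreover have "dtarget k (drop_at p R) d (enc_list (map enc_nat \<tau>)) =
        enc_nat (target k \<pi> (drop_at p R) \<tau>)" for p
      using assms set_drop_at[of p R] by (intro dtarget_enc) (auto simp: remainders)
    ultimately show ?thesis
      using False by (simp add: dgate_def node_gate_def t t_def[symmetric] comp_def del: upt_Suc)
  qed
qed

lemma dentry_enc:
  assumes "\<tau> \<in> tuples k \<pi>" "R \<in> set (remainders k)"
  shows "dentry k R d (enc_list (map enc_nat \<tau>)) =
    enc_list [enc_nat (code (\<tau> @ R)), enc_gate (gate C (code (\<tau> @ R)))]"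
  using assms by (simp add: dentry_def dgate_enc gate_C dappend_enc_list dcode_enc flip: map_append)

lemma represents_dcircuit: "represents_circuit (dcircuit k d) C"
proof -
  let ?N = "length (roles k)"
  let ?code = "\<lambda>(\<tau>, R). code (\<tau> @ R)"
  \<comment> \<open>The nodes are listed in the order in which the program emits them.\<close>
  define us where "us = map ?code (List.product (List.n_lists ?N vs) (remainders k))"
  have tuples: "set (List.n_lists ?N vs) = tuples k \<pi>"
    using vs by (auto simp: set_n_lists tuples_def lists_set_def)
  \<comment> \<open>All tuples have the same length, so the concatenation determines both of its
    parts.\<close>
  have "inj_on ?code (tuples k \<pi> \<times> set (remainders k))"
    by (auto simp: inj_on_def tuples_def dest!: injD[OF inj_code])
  then have "lists_set us (nodes C)"
    using vs by (simp add: us_def lists_set_def distinct_map distinct_product distinct_n_lists remainders(1)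
        tuples nodes_protocol_circuit)
  moreover have "dconcat_map (\<lambda>d \<tau>. enc_list (map (\<lambda>R. dentry k R d \<tau>) (remainders k))) d
       (dn_lists ?N (dnth 0 d)) =
      enc_list (map (\<lambda>v. enc_list [enc_nat v, enc_gate (gate C v)]) us)"
    unfolding dnth_d dn_lists_enc
    by (subst dconcat_map_enc_list[where g = "\<lambda>\<tau>. map (\<lambda>R. enc_list [enc_nat (code (\<tau> @ R)),
          enc_gate (gate C (code (\<tau> @ R)))]) (remainders k)"])
      (auto simp: us_def tuples dentry_enc product_concat_map map_concat comp_def
        simp del: enc_list.simps cong: map_cong)
  moreover have "dcode (dappend (enc_list (map (\<lambda>_. dnth 1 d) [0..<?N]))
      (enc_list (map enc_nat [0..<length (classes k)]))) = enc_nat (out C)"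
  proof -
    have "map (\<lambda>_. dnth 1 d) [0..<?N] = map enc_nat (replicate ?N (start \<pi>))"
      unfolding dnth_d by (simp add: map_replicate_trivial map_replicate_const)
    then show ?thesis
      by (simp only: dappend_enc_list map_append[symmetric] dcode_enc out_protocol_circuit)
  qed
  ultimately show ?thesis
    unfolding represents_circuit_def dcircuit_def by (intro exI[of _ us]) simp
qed

end

lemma represents_circuit_dcircuit:
  assumes "represents_light_form k d (light_form_of \<pi>)"
  shows "represents_circuit (dcircuit k d) C"
proof -
  have fields: "dag (light_form_of \<pi>) = dag \<pi>" "start (light_form_of \<pi>) = start \<pi>"
    "arc_label (light_form_of \<pi>) = arc_label \<pi>" "part (light_form_of \<pi>) = part \<pi>"
    "out_label (light_form_of \<pi>) = out_label \<pi>"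
    by (simp_all add: light_form_of_def light_form.truncate_def)
  then have "terminals (light_form_of \<pi>) = terminals \<pi>"
    by (simp add: terminals_def)
  with assms show ?thesis
    unfolding represents_light_form_def fields using represents_dcircuit by (auto simp del: upt_Suc enc_list.simps)
qed

end

theorem theorem6:
  fixes k :: nat
  assumes "2 \<le> k"
  shows "\<exists>A c e. polynomial_time A \<and>
    (\<forall>(n :: nat) (f :: bool list \<Rightarrow> bool) (\<pi> :: bool list protocol) (d :: data).
       f \<in> Q k n \<longrightarrow>
       is_protocol k {..<n} \<pi> \<longrightarrow>
       strongly_computes k n f \<pi> \<longrightarrow>
       represents_light_form k d (light_form_of \<pi>) \<longrightarrow>
       (\<exists>C d'. outputs A d d' \<and> represents_circuit d' C \<and>
          thr_circuit (k + 1) n C \<and> circuit_le n C f \<and>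
          circuit_depth C \<le> c * protocol_depth \<pi> \<and>
          circuit_size C \<le> c * protocol_size \<pi> ^ e))"
proof -
  obtain A where A: "polynomial_time A" "\<And>d. outputs A d (dcircuit k d)"
    using polynomial_time_of_ptime[OF ptime_circuit] by blast
  \<comment> \<open>One constant serves both bounds: the first summand for the depth, the second for
    the size. Like the exponent \<open>length (roles k)\<close>, it depends on \<open>k\<close>
    only.\<close>
  define c where "c = length (classes k) + length (remainders k)"
  have "\<exists>C d'. outputs A d d' \<and> represents_circuit d' C \<and>
          thr_circuit (k + 1) n C \<and> circuit_le n C f \<and>
          circuit_depth C \<le> c * protocol_depth \<pi> \<and>
          circuit_size C \<le> c * protocol_size \<pi> ^ length (roles k)"
    if "is_protocol k {..<n} \<pi>" "strongly_computes k n f \<pi>"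
      "represents_light_form k d (light_form_of \<pi>)" for n f \<pi> d
  proof -
    interpret strong_protocol k n f \<pi>
      using that assms by unfold_locales auto
    have "length (classes k) * protocol_depth \<pi> \<le> c * protocol_depth \<pi>"
      "length (remainders k) * protocol_size \<pi> ^ length (roles k) \<le> c * protocol_size \<pi> ^ length (roles k)"
      by (simp_all add: c_def)
    then have "circuit_depth C \<le> c * protocol_depth \<pi>"
      "circuit_size C \<le> c * protocol_size \<pi> ^ length (roles k)"
      using circuit_depth_C circuit_size_C by linarith+
    then show ?thesis
      using A(2)[of d] represents_circuit_dcircuit[OF that(3)] thr_circuit_C circuit_le_C
      by (intro exI[of _ C] exI[of _ "dcircuit k d"] conjI)
  qed
  with A(1) show ?thesis by blast
qed

end
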